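(* Let $\mathcal{S} = (\Lambda, \mathcal{R})$ be a graph transformation system. For all states $J \to G$ and $K \to H$ and every label $J \to F \gets K$, there is a BC-transition $(J \to G) \xrightarrow{J \to F \gets K} (K \to H)$ if and only if this transition is derivable in the SOSBC-system of $\mathcal{S}$.
   Context: **Hypergraphs.** Let $\Lambda$ be a set of labels with arity function $\mathrm{ar}\colon \Lambda \to \mathbb{N}$. A hypergraph $G=(E,V,\ell,\mathrm{cnct})$ has a set $E$ of edges, a set $V$ of nodes, a labelling $\ell\colon E\to\Lambda$, and a connection function assigning to each $e\in E$ a string $\mathrm{cnct}(e)=v_1\cdots v_n$ of (incident) nodes, with $n=\mathrm{ar}(\ell(e))$. Morphisms are pairs of functions on edges and nodes that preserve labels and connections. $G_1\to G_2$ (or $G_2\gets G_1$) denotes an inclusion, i.e. $G_1$ is a sub-graph of $G_2$. All arrows below are inclusions. Pullbacks of inclusions are intersections. Inclusions $G_1\gets G_0\to G_2$ are non-overlapping if $E_1\cap E_2\subseteq E_0$ and $V_1\cap V_2\subseteq V_0$; the pushout of non-overlapping inclusions is the union of $G_1$ and $G_2$. A pushout complement of $G_2\gets G_1\gets G_0$ is a sub-graph $D$ of $G_2$ with $G_0\to D$ such that $G_0\to G_1$, $G_0\to D$, $G_1\to G_2$, $D\to G_2$ form a pushout square; it is unique if it exists. **Systems.** A rule is a pair of non-overlapping inclusions $L\gets I\to R$. A graph transformation system is a pair $(\Lambda,\mathcal{R})$ with $\mathcal{R}$ a set of rules. By convention, a rule may always be replaced by an isomorphic instance, so that the relevant inclusions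 are non-overlapping, and results of constructions are considered up to isomorphism. **BC-transitions.** A state is an inclusion $J\to G$ ($J$ is the interface). A label is a pair of inclusions $J\to F\gets K$. There is a BC-transition $(J\to G)\xrightarrow{J\to F\gets K}(K\to H)$ if there are a rule $L\gets I\to R$ in $\mathcal{R}$ and graphs $D, G_c, C$ such that - $G_c$ is the pushout of $L\gets D\to G$; - $G_c$ is the pushout of $G\gets J\to F$; - the square $I\to L$, $I\to C$, $L\to G_c$, $C\to G_c$ is a pushout; - $H$ is the pushout of $C\gets I\to R$; - $K$ is the pullback of $F\to G_c\gets C$; - $K\to H$ is the composite $K\to C\to H$. **SOSBC-system.** It derives transitions of the form $(J\to G)\xrightarrow{J\to F\gets K}(K\to H)$ by the following axioms and rules. 1. *Basic Actions.* For every rule $L\gets I\to R$ in $\mathcal{R}$ and every inclusion $D\to L$, the transition $(D\to D)\xrightarrow{D\to L\gets I}(I\to R)$ is an axiom. 2. *Interface Narrowing.* From $(J\to G)\xrightarrow{J\to F\gets K}(K\to H)$ and an inclusion $J'\to J$ such that the pushout complement $F'$ of $F\gets J\gets J'$ exists, derive $(J'\to G)\xrightarrow{J'\to F'\gets K'}(K'\to H)$, where $K'$ is the pullback of $F'\to F\gets K$. 3. *Compatible Contextualization.* A context is a pair of inclusions $J\to E\gets\bar J$. It is monotone if $J\to\bar J$. It is non-inhibiting w.r.t. a label $J\to F\gets K$ if there are graphs $E_1,E'$ such that $E_1$ is the pushout of $E\gets J\to F$ and the square $K\to F$, $K\to E'$, $F\to E_1$, $E'\to E_1$ is a pushout. It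 is compatible with the label if it is both monotone and non-inhibiting. In this case there is a graph $\bar F$ such that $\bar J\to E$, $\bar J\to\bar F$, $E\to E_1$, $\bar F\to E_1$ form a pushout square; let $\bar K$ be the pullback of $\bar F\to E_1\gets E'$. From $(J\to G)\xrightarrow{J\to F\gets K}(K\to H)$ and a context $J\to E\gets\bar J$ compatible with $J\to F\gets K$, derive $$(\bar J\to\bar G)\xrightarrow{\bar J\to\bar F\gets\bar K}(\bar K\to\bar H),$$ where $\bar G$ is the pushout of $E\gets J\to G$ with $\bar J\to E\to\bar G$, and $\bar H$ is the pushout of $E'\gets K\to H$ with $\bar K\to E'\to\bar H$. *)

theory Defs
  imports Main "HOL-Library.FuncSet" "HOL-Library.Infinite_Typeclass"
begin

section \<open>Hypergraphs and morphisms\<close>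

record 'l signature =
  labels :: "'l set"
  arity :: "'l \<Rightarrow> nat"

record ('e, 'v, 'l) hgraph =
  edges :: "'e set"
  nodes :: "'v set"
  lab :: "'e \<Rightarrow> 'l"
  cnct :: "'e \<Rightarrow> 'v list"

text \<open>The labelling and the connection function are functions on the set of edges; requiring them
  to be extensional outside of that set makes equality of hypergraphs coincide with equality of
  the records.\<close>

definition hypergraph :: "'l signature \<Rightarrow> ('e, 'v, 'l) hgraph \<Rightarrow> bool" where
  "hypergraph \<Sigma> G \<longleftrightarrow>
     lab G \<in> edges G \<rightarrow>\<^sub>E labels \<Sigma> \<and>
     cnct G \<in> edges G \<rightarrow>\<^sub>E lists (nodes G) \<and>
     (\<forall>e \<in> edges G. length (cnct G e) = arity \<Sigma> (lab G e))"

type_synonym ('e, 'v, 'e2, 'v2) hmap = "('e \<Rightarrow> 'e2) \<times> ('v \<Rightarrow> 'v2)"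

definition morphism ::
  "'l signature \<Rightarrow> ('e, 'v, 'e2, 'v2) hmap \<Rightarrow> ('e, 'v, 'l) hgraph \<Rightarrow> ('e2, 'v2, 'l) hgraph \<Rightarrow> bool"
where
  "morphism \<Sigma> \<phi> G H \<longleftrightarrow>
     hypergraph \<Sigma> G \<and> hypergraph \<Sigma> H \<and>
     fst \<phi> ` edges G \<subseteq> edges H \<and> snd \<phi> ` nodes G \<subseteq> nodes H \<and>
     (\<forall>e \<in> edges G. lab H (fst \<phi> e) = lab G e \<and> cnct H (fst \<phi> e) = map (snd \<phi>) (cnct G e))"

definition isomorphism ::
  "'l signature \<Rightarrow> ('e, 'v, 'e2, 'v2) hmap \<Rightarrow> ('e, 'v, 'l) hgraph \<Rightarrow> ('e2, 'v2, 'l) hgraph \<Rightarrow> bool"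
where
  "isomorphism \<Sigma> \<phi> G H \<longleftrightarrow> morphism \<Sigma> \<phi> G H \<and>
     bij_betw (fst \<phi>) (edges G) (edges H) \<and> bij_betw (snd \<phi>) (nodes G) (nodes H)"

definition agree_on ::
  "('e, 'v, 'l) hgraph \<Rightarrow> ('e, 'v, 'e2, 'v2) hmap \<Rightarrow> ('e, 'v, 'e2, 'v2) hmap \<Rightarrow> bool" where
  "agree_on G \<phi> \<psi> \<longleftrightarrow>
     (\<forall>e \<in> edges G. fst \<phi> e = fst \<psi> e) \<and> (\<forall>v \<in> nodes G. snd \<phi> v = snd \<psi> v)"

definition inclusion :: "'l signature \<Rightarrow> ('e, 'v, 'l) hgraph \<Rightarrow> ('e, 'v, 'l) hgraph \<Rightarrow> bool" where
  "inclusion \<Sigma> G H \<longleftrightarrow> morphism \<Sigma> (id, id) G H"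


section \<open>Pullbacks and pushouts of inclusions\<close>

definition inter_graph ::
  "('e, 'v, 'l) hgraph \<Rightarrow> ('e, 'v, 'l) hgraph \<Rightarrow> ('e, 'v, 'l) hgraph" where
  "inter_graph G1 G2 =
     \<lparr>edges = edges G1 \<inter> edges G2, nodes = nodes G1 \<inter> nodes G2,
      lab = restrict (lab G1) (edges G1 \<inter> edges G2),
      cnct = restrict (cnct G1) (edges G1 \<inter> edges G2)\<rparr>"

definition union_graph ::
  "('e, 'v, 'l) hgraph \<Rightarrow> ('e, 'v, 'l) hgraph \<Rightarrow> ('e, 'v, 'l) hgraph" where
  "union_graph G1 G2 =
     \<lparr>edges = edges G1 \<union> edges G2, nodes = nodes G1 \<union> nodes G2,
      lab = (\<lambda>e. if e \<in> edges G1 then lab G1 e else lab G2 e),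
      cnct = (\<lambda>e. if e \<in> edges G1 then cnct G1 e else cnct G2 e)\<rparr>"

definition non_overlapping ::
  "'l signature \<Rightarrow> ('e, 'v, 'l) hgraph \<Rightarrow> ('e, 'v, 'l) hgraph \<Rightarrow> ('e, 'v, 'l) hgraph \<Rightarrow> bool" where
  "non_overlapping \<Sigma> G1 G0 G2 \<longleftrightarrow> inclusion \<Sigma> G0 G1 \<and> inclusion \<Sigma> G0 G2 \<and>
     edges G1 \<inter> edges G2 \<subseteq> edges G0 \<and> nodes G1 \<inter> nodes G2 \<subseteq> nodes G0"

text \<open>\<open>pullback \<Sigma> G1 P G2 K\<close>: \<open>K\<close> is the pullback of the inclusions of \<open>G1\<close> and \<open>G2\<close> into \<open>P\<close>.
  \<open>pushout \<Sigma> G1 G0 G2 P\<close>: \<open>P\<close> is the pushout of the non-overlapping inclusions of \<open>G0\<close> into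
  \<open>G1\<close> and \<open>G2\<close>.  The lemmas below show that these are the categorical notions.\<close>

definition pullback ::
  "'l signature \<Rightarrow> ('e, 'v, 'l) hgraph \<Rightarrow> ('e, 'v, 'l) hgraph \<Rightarrow> ('e, 'v, 'l) hgraph
    \<Rightarrow> ('e, 'v, 'l) hgraph \<Rightarrow> bool" where
  "pullback \<Sigma> G1 P G2 K \<longleftrightarrow> inclusion \<Sigma> G1 P \<and> inclusion \<Sigma> G2 P \<and> K = inter_graph G1 G2"

definition pushout ::
  "'l signature \<Rightarrow> ('e, 'v, 'l) hgraph \<Rightarrow> ('e, 'v, 'l) hgraph \<Rightarrow> ('e, 'v, 'l) hgraph
    \<Rightarrow> ('e, 'v, 'l) hgraph \<Rightarrow> bool" where
  "pushout \<Sigma> G1 G0 G2 P \<longleftrightarrow> non_overlapping \<Sigma> G1 G0 G2 \<and> P = union_graph G1 G2"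

text \<open>\<open>D\<close> is the pushout complement of the inclusions of \<open>G0\<close> into \<open>G1\<close> and of \<open>G1\<close> into \<open>G2\<close>.\<close>

definition pushout_complement ::
  "'l signature \<Rightarrow> ('e, 'v, 'l) hgraph \<Rightarrow> ('e, 'v, 'l) hgraph \<Rightarrow> ('e, 'v, 'l) hgraph
    \<Rightarrow> ('e, 'v, 'l) hgraph \<Rightarrow> bool" where
  "pushout_complement \<Sigma> G2 G1 G0 D \<longleftrightarrow>
     inclusion \<Sigma> G0 G1 \<and> inclusion \<Sigma> G1 G2 \<and> inclusion \<Sigma> D G2 \<and> pushout \<Sigma> G1 G0 D G2"

lemma pullback_inclusions:
  assumes "pullback \<Sigma> G1 P G2 K"
  shows "inclusion \<Sigma> K G1" "inclusion \<Sigma> K G2"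
  using assms
  unfolding pullback_def inclusion_def morphism_def hypergraph_def inter_graph_def PiE_def Pi_def
  by (auto simp: subset_iff in_lists_conv_set dest: spec)

lemma pullback_universal:
  assumes "pullback \<Sigma> G1 P G2 K"
    and "morphism \<Sigma> \<phi>1 X G1" "morphism \<Sigma> \<phi>2 X G2" "agree_on X \<phi>1 \<phi>2"
  shows "morphism \<Sigma> \<phi>1 X K"
proof -
  have "hypergraph \<Sigma> K"
    using pullback_inclusions[OF assms(1)] by (simp add: inclusion_def morphism_def)
  then show ?thesis
    using assms unfolding pullback_def morphism_def inter_graph_def agree_on_def
    by (auto simp: image_subset_iff)
qed

lemma pushout_inclusions:
  assumes "pushout \<Sigma> G1 G0 G2 P"
  shows "inclusion \<Sigma> G1 P" "inclusion \<Sigma> G2 P"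
proof -
  note defs = pushout_def non_overlapping_def inclusion_def morphism_def hypergraph_def
    union_graph_def PiE_def Pi_def extensional_def
  have agree: "lab G1 e = lab G2 e \<and> cnct G1 e = cnct G2 e" if "e \<in> edges G1" "e \<in> edges G2" for e
    using assms that unfolding pushout_def non_overlapping_def inclusion_def morphism_def
    by (metis IntI eq_id_iff fst_conv list.map_id snd_conv subsetD)
  have hyp: "hypergraph \<Sigma> G1" "hypergraph \<Sigma> G2" and P: "P = union_graph G1 G2"
    using assms by (auto simp: pushout_def non_overlapping_def inclusion_def morphism_def)
  have "hypergraph \<Sigma> P"
    using hyp unfolding P hypergraph_def union_graph_def PiE_def Pi_def extensional_def
    by (auto simp: subset_iff in_lists_conv_set)
  then show "inclusion \<Sigma> G1 P" "inclusion \<Sigma> G2 P"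
    using hyp agree unfolding inclusion_def morphism_def by (auto simp: P union_graph_def)
qed

lemma pushout_universal:
  assumes po: "pushout \<Sigma> G1 G0 G2 P"
    and m: "morphism \<Sigma> \<phi>1 G1 X" "morphism \<Sigma> \<phi>2 G2 X" and ag: "agree_on G0 \<phi>1 \<phi>2"
  shows "\<exists>\<psi>. morphism \<Sigma> \<psi> P X \<and> agree_on G1 \<psi> \<phi>1 \<and> agree_on G2 \<psi> \<phi>2 \<and>
           (\<forall>\<psi>'. agree_on G1 \<psi>' \<phi>1 \<and> agree_on G2 \<psi>' \<phi>2 \<longrightarrow> agree_on P \<psi>' \<psi>)"
proof -
  define \<psi> where
    "\<psi> = (\<lambda>e. if e \<in> edges G1 then fst \<phi>1 e else fst \<phi>2 e,
          \<lambda>v. if v \<in> nodes G1 then snd \<phi>1 v else snd \<phi>2 v)"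
  have P: "edges P = edges G1 \<union> edges G2" "nodes P = nodes G1 \<union> nodes G2"
    using po by (auto simp: pushout_def union_graph_def)
  have a1: "agree_on G1 \<psi> \<phi>1" by (simp add: agree_on_def \<psi>_def)
  have a2: "agree_on G2 \<psi> \<phi>2"
    using po ag by (auto simp: agree_on_def \<psi>_def pushout_def non_overlapping_def)
  have hyp: "hypergraph \<Sigma> P" "hypergraph \<Sigma> X"
    using pushout_inclusions[OF po] m by (auto simp: inclusion_def morphism_def)
  have step: "lab X (fst \<psi> e) = lab P e \<and> cnct X (fst \<psi> e) = map (snd \<psi>) (cnct P e)"
    if "inclusion \<Sigma> G P" "morphism \<Sigma> \<phi> G X" "agree_on G \<psi> \<phi>" "e \<in> edges G" for G \<phi> e
  proof -
    have "set (cnct G e) \<subseteq> nodes G"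
      using that by (auto simp: morphism_def hypergraph_def PiE_def Pi_def in_lists_conv_set)
    then have "map (snd \<psi>) (cnct G e) = map (snd \<phi>) (cnct G e)"
      using that by (auto simp: agree_on_def)
    then show ?thesis
      using that by (auto simp: agree_on_def inclusion_def morphism_def)
  qed
  have im: "fst \<psi> ` edges P \<subseteq> edges X" "snd \<psi> ` nodes P \<subseteq> nodes X"
    using a1 a2 m by (auto simp: P agree_on_def morphism_def image_subset_iff)
  have "morphism \<Sigma> \<psi> P X"
    unfolding morphism_def
  proof (intro conjI ballI)
    fix e assume "e \<in> edges P"
    then consider "e \<in> edges G1" | "e \<in> edges G2" by (auto simp: P)
    then show "lab X (fst \<psi> e) = lab P e" "cnct X (fst \<psi> e) = map (snd \<psi>) (cnct P e)"
      using step[OF pushout_inclusions(1)[OF po] m(1) a1]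
        step[OF pushout_inclusions(2)[OF po] m(2) a2] by (cases; blast)+
  qed (use hyp im in auto)
  moreover have "agree_on P \<psi>' \<psi>" if "agree_on G1 \<psi>' \<phi>1 \<and> agree_on G2 \<psi>' \<phi>2" for \<psi>'
    using that a1 a2 by (auto simp: agree_on_def P)
  ultimately show ?thesis using a1 a2 by blast
qed


section \<open>Graph transformation systems\<close>

text \<open>A rule with left-hand side \<open>L\<close>, interface \<open>I\<close> and right-hand side \<open>R\<close> is the triple
  \<open>(L, I, R)\<close>.\<close>

type_synonym ('e, 'v, 'l) rule =
  "('e, 'v, 'l) hgraph \<times> ('e, 'v, 'l) hgraph \<times> ('e, 'v, 'l) hgraph"

definition is_rule :: "'l signature \<Rightarrow> ('e, 'v, 'l) rule \<Rightarrow> bool" where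
  "is_rule \<Sigma> r = (case r of (L, I, R) \<Rightarrow> non_overlapping \<Sigma> L I R)"

definition graph_transformation_system :: "'l signature \<Rightarrow> ('e, 'v, 'l) rule set \<Rightarrow> bool" where
  "graph_transformation_system \<Sigma> \<R> \<longleftrightarrow> (\<forall>r \<in> \<R>. is_rule \<Sigma> r)"

text \<open>Rules may be replaced by isomorphic instances, i.e. by rules \<open>(L, I, R)\<close> with isomorphisms on
  all three components that commute with the inclusions of the interfaces.\<close>

definition rule_instance ::
  "'l signature \<Rightarrow> ('e, 'v, 'l) rule set \<Rightarrow> ('e, 'v, 'l) hgraph \<Rightarrow> ('e, 'v, 'l) hgraph
    \<Rightarrow> ('e, 'v, 'l) hgraph \<Rightarrow> bool" where
  "rule_instance \<Sigma> \<R> L I R \<longleftrightarrow> is_rule \<Sigma> (L, I, R) \<and>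
     (\<exists>(L0, I0, R0) \<in> \<R>. \<exists>l r.
        isomorphism \<Sigma> l L0 L \<and> isomorphism \<Sigma> r R0 R \<and> isomorphism \<Sigma> l I0 I \<and> agree_on I0 l r)"


section \<open>Transitions\<close>

definition is_state :: "'l signature \<Rightarrow> ('e, 'v, 'l) hgraph \<Rightarrow> ('e, 'v, 'l) hgraph \<Rightarrow> bool" where
  "is_state \<Sigma> J G \<longleftrightarrow> inclusion \<Sigma> J G"

definition is_label ::
  "'l signature \<Rightarrow> ('e, 'v, 'l) hgraph \<Rightarrow> ('e, 'v, 'l) hgraph \<Rightarrow> ('e, 'v, 'l) hgraph \<Rightarrow> bool" where
  "is_label \<Sigma> J F K \<longleftrightarrow> inclusion \<Sigma> J F \<and> inclusion \<Sigma> K F"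

text \<open>A transition from state \<open>J \<rightarrow> G\<close> to state \<open>K \<rightarrow> H\<close> with label \<open>J \<rightarrow> F \<leftarrow> K\<close> is represented by
  the five graphs \<open>J G F K H\<close>.  Two transitions are isomorphic if there are isomorphisms between
  corresponding graphs that commute with the inclusions of \<open>J\<close> into \<open>G\<close> and \<open>F\<close> and of \<open>K\<close> into
  \<open>F\<close> and \<open>H\<close>; those on \<open>J\<close> and \<open>K\<close> are then restrictions of those on \<open>G\<close>, \<open>F\<close> and \<open>H\<close>.\<close>

definition transition_iso ::
  "'l signature
    \<Rightarrow> ('e, 'v, 'l) hgraph \<Rightarrow> ('e, 'v, 'l) hgraph \<Rightarrow> ('e, 'v, 'l) hgraph
    \<Rightarrow> ('e, 'v, 'l) hgraph \<Rightarrow> ('e, 'v, 'l) hgraph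
    \<Rightarrow> ('e, 'v, 'l) hgraph \<Rightarrow> ('e, 'v, 'l) hgraph \<Rightarrow> ('e, 'v, 'l) hgraph
    \<Rightarrow> ('e, 'v, 'l) hgraph \<Rightarrow> ('e, 'v, 'l) hgraph \<Rightarrow> bool" where
  "transition_iso \<Sigma> J G F K H J' G' F' K' H' \<longleftrightarrow>
     is_state \<Sigma> J G \<and> is_label \<Sigma> J F K \<and> is_state \<Sigma> K H \<and>
     is_state \<Sigma> J' G' \<and> is_label \<Sigma> J' F' K' \<and> is_state \<Sigma> K' H' \<and>
     (\<exists>g f h.
        isomorphism \<Sigma> g G G' \<and> isomorphism \<Sigma> f F F' \<and> isomorphism \<Sigma> h H H' \<and>
        isomorphism \<Sigma> g J J' \<and> agree_on J g f \<and>
        isomorphism \<Sigma> f K K' \<and> agree_on K f h)"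

text \<open>In \<open>bc_diagram\<close> all constructions are literal unions and intersections; the inclusion of
  \<open>K\<close> into \<open>H\<close> is then automatically the composite through \<open>C\<close>.\<close>

definition bc_diagram ::
  "'l signature \<Rightarrow> ('e, 'v, 'l) rule set
    \<Rightarrow> ('e, 'v, 'l) hgraph \<Rightarrow> ('e, 'v, 'l) hgraph \<Rightarrow> ('e, 'v, 'l) hgraph
    \<Rightarrow> ('e, 'v, 'l) hgraph \<Rightarrow> ('e, 'v, 'l) hgraph \<Rightarrow> bool" where
  "bc_diagram \<Sigma> \<R> J G F K H \<longleftrightarrow>
     is_state \<Sigma> J G \<and> is_label \<Sigma> J F K \<and> is_state \<Sigma> K H \<and>
     (\<exists>L I R D Gc C.
        rule_instance \<Sigma> \<R> L I R \<and>
        pushout \<Sigma> L D G Gc \<and>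
        pushout \<Sigma> G J F Gc \<and>
        pushout \<Sigma> L I C Gc \<and>
        pushout \<Sigma> C I R H \<and>
        pullback \<Sigma> F Gc C K)"

text \<open>The results of constructions, hence transitions, are considered up to isomorphism.  In
  particular, a transition between given graphs must not depend on accidental overlaps, e.g. of
  \<open>F\<close> with parts of \<open>G\<close> outside of \<open>J\<close>.\<close>

definition bc_transition ::
  "'l signature \<Rightarrow> ('e, 'v, 'l) rule set
    \<Rightarrow> ('e, 'v, 'l) hgraph \<Rightarrow> ('e, 'v, 'l) hgraph \<Rightarrow> ('e, 'v, 'l) hgraph
    \<Rightarrow> ('e, 'v, 'l) hgraph \<Rightarrow> ('e, 'v, 'l) hgraph \<Rightarrow> bool" where
  "bc_transition \<Sigma> \<R> J G F K H \<longleftrightarrow>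
     (\<exists>J0 G0 F0 K0 H0.
        bc_diagram \<Sigma> \<R> J0 G0 F0 K0 H0 \<and> transition_iso \<Sigma> J0 G0 F0 K0 H0 J G F K H)"


section \<open>The SOSBC-system\<close>

text \<open>\<open>J \<rightarrow> E \<leftarrow> J'\<close> is a context; \<open>J'\<close> is the interface after contextualization.\<close>

definition is_context ::
  "'l signature \<Rightarrow> ('e, 'v, 'l) hgraph \<Rightarrow> ('e, 'v, 'l) hgraph \<Rightarrow> ('e, 'v, 'l) hgraph \<Rightarrow> bool" where
  "is_context \<Sigma> J E J' \<longleftrightarrow> inclusion \<Sigma> J E \<and> inclusion \<Sigma> J' E"

definition monotone_context ::
  "'l signature \<Rightarrow> ('e, 'v, 'l) hgraph \<Rightarrow> ('e, 'v, 'l) hgraph \<Rightarrow> ('e, 'v, 'l) hgraph \<Rightarrow> bool" where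
  "monotone_context \<Sigma> J E J' \<longleftrightarrow> is_context \<Sigma> J E J' \<and> inclusion \<Sigma> J J'"

definition non_inhibiting_via ::
  "'l signature
    \<Rightarrow> ('e, 'v, 'l) hgraph \<Rightarrow> ('e, 'v, 'l) hgraph \<Rightarrow> ('e, 'v, 'l) hgraph \<Rightarrow> ('e, 'v, 'l) hgraph
    \<Rightarrow> ('e, 'v, 'l) hgraph \<Rightarrow> ('e, 'v, 'l) hgraph \<Rightarrow> bool" where
  "non_inhibiting_via \<Sigma> J E F K E1 E' \<longleftrightarrow> pushout \<Sigma> E J F E1 \<and> pushout \<Sigma> F K E' E1"

text \<open>The graphs \<open>E1\<close> and \<open>E'\<close> witnessing that a context is non-inhibiting are used in the
  conclusion of the contextualization rule, so they are arguments of \<open>compatible_via\<close>.\<close>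

definition compatible_via ::
  "'l signature
    \<Rightarrow> ('e, 'v, 'l) hgraph \<Rightarrow> ('e, 'v, 'l) hgraph \<Rightarrow> ('e, 'v, 'l) hgraph
    \<Rightarrow> ('e, 'v, 'l) hgraph \<Rightarrow> ('e, 'v, 'l) hgraph
    \<Rightarrow> ('e, 'v, 'l) hgraph \<Rightarrow> ('e, 'v, 'l) hgraph \<Rightarrow> bool" where
  "compatible_via \<Sigma> J E J' F K E1 E' \<longleftrightarrow>
     monotone_context \<Sigma> J E J' \<and> non_inhibiting_via \<Sigma> J E F K E1 E'"

text \<open>The rule \<open>up_to_iso\<close> implements the convention that the results of constructions are
  considered up to isomorphism; it also allows one to rename a derived transition apart from a
  context.\<close>

inductive sosbc ::
  "'l signature \<Rightarrow> ('e, 'v, 'l) rule set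
    \<Rightarrow> ('e, 'v, 'l) hgraph \<Rightarrow> ('e, 'v, 'l) hgraph \<Rightarrow> ('e, 'v, 'l) hgraph
    \<Rightarrow> ('e, 'v, 'l) hgraph \<Rightarrow> ('e, 'v, 'l) hgraph \<Rightarrow> bool"
  for \<Sigma> :: "'l signature" and \<R> :: "('e, 'v, 'l) rule set"
where
  basic_action:
    "rule_instance \<Sigma> \<R> L I R \<Longrightarrow> inclusion \<Sigma> D L \<Longrightarrow> sosbc \<Sigma> \<R> D D L I R"
| interface_narrowing:
    "sosbc \<Sigma> \<R> J G F K H \<Longrightarrow>
     inclusion \<Sigma> J' J \<Longrightarrow>
     pushout_complement \<Sigma> F J J' F' \<Longrightarrow>
     pullback \<Sigma> F' F K K' \<Longrightarrow>
     sosbc \<Sigma> \<R> J' G F' K' H"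
| compatible_contextualization:
    "sosbc \<Sigma> \<R> J G F K H \<Longrightarrow>
     compatible_via \<Sigma> J E J' F K E1 E' \<Longrightarrow>
     pushout \<Sigma> E J' F' E1 \<Longrightarrow>
     pullback \<Sigma> F' E1 E' K' \<Longrightarrow>
     pushout \<Sigma> E J G G' \<Longrightarrow>
     pushout \<Sigma> E' K H H' \<Longrightarrow>
     sosbc \<Sigma> \<R> J' G' F' K' H'"
| up_to_iso:
    "sosbc \<Sigma> \<R> J G F K H \<Longrightarrow>
     transition_iso \<Sigma> J G F K H J' G' F' K' H' \<Longrightarrow>
     sosbc \<Sigma> \<R> J' G' F' K' H'"

end

theory Submission
  imports Defs
begin

text \<open>Completeness: given a BC-diagram, start from the basic action on \<open>D \<rightarrow> L\<close>, put it into the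
  context \<open>D \<rightarrow> G \<leftarrow> J \<union> D\<close> (where \<open>E\<^sub>1 = G\<^sub>c\<close> and \<open>E' = C\<close>), and narrow the interface to \<open>J\<close>.

  Soundness: BC-transitions are closed under the rules. The rule, its match and \<open>D\<close> never
  change. Narrowing keeps \<open>G\<^sub>c\<close> and \<open>C\<close>, and contextualization enlarges them by \<open>E\<close> and \<open>E'\<close>.
  As the context may overlap with the graphs of the diagram, the diagram is first moved into one
  half of the infinite types of edges and nodes; the new part of \<open>E\<close> goes into the other half.\<close>

section \<open>Graphs as sets of edges and nodes\<close>

text \<open>A disjoint sum joins edges and nodes, so that each gluing condition is one set equation
  instead of two.\<close>

definition parts :: "('e, 'v, 'l) hgraph \<Rightarrow> ('e + 'v) set" where
  "parts G = edges G <+> nodes G"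

definition on_parts :: "('e, 'v, 'e2, 'v2) hmap \<Rightarrow> 'e + 'v \<Rightarrow> 'e2 + 'v2" where
  "on_parts \<phi> = map_sum (fst \<phi>) (snd \<phi>)"

lemma Inl_in_parts [simp]: "Inl e \<in> parts G \<longleftrightarrow> e \<in> edges G"
  and Inr_in_parts [simp]: "Inr v \<in> parts G \<longleftrightarrow> v \<in> nodes G"
  by (auto simp: parts_def)

lemma parts_subset_iff: "parts X \<subseteq> parts Y \<longleftrightarrow> edges X \<subseteq> edges Y \<and> nodes X \<subseteq> nodes Y"
  by (auto simp: parts_def)

lemma parts_eq_iff: "parts X = parts Y \<longleftrightarrow> edges X = edges Y \<and> nodes X = nodes Y"
  by (auto simp: set_eq_subset parts_subset_iff)

lemma parts_union_graph [simp]: "parts (union_graph X Y) = parts X \<union> parts Y"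
  by (auto simp: parts_def union_graph_def)

lemma parts_inter_graph [simp]: "parts (inter_graph X Y) = parts X \<inter> parts Y"
  by (auto simp: parts_def inter_graph_def)

lemma agree_on_parts: "agree_on G \<phi> \<psi> \<longleftrightarrow> (\<forall>x \<in> parts G. on_parts \<phi> x = on_parts \<psi> x)"
  unfolding agree_on_def on_parts_def parts_def Plus_def ball_Un by auto

lemma agree_on_image: "agree_on G \<phi> \<psi> \<Longrightarrow> on_parts \<phi> ` parts G = on_parts \<psi> ` parts G"
  by (auto simp: agree_on_parts)

lemma inj_on_parts_iff:
  "inj_on (on_parts \<phi>) (parts G) \<longleftrightarrow> inj_on (fst \<phi>) (edges G) \<and> inj_on (snd \<phi>) (nodes G)"
  unfolding inj_on_def parts_def Plus_def ball_Un by (auto simp: on_parts_def)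

section \<open>Inclusions, pushouts and pullbacks as conditions on sets\<close>

lemma inclusion_altdef:
  "inclusion \<Sigma> X Y \<longleftrightarrow> hypergraph \<Sigma> X \<and> hypergraph \<Sigma> Y \<and> parts X \<subseteq> parts Y \<and>
     (\<forall>e \<in> edges X. lab Y e = lab X e \<and> cnct Y e = cnct X e)"
  by (auto simp: inclusion_def morphism_def parts_subset_iff)

lemma inclusion_hypergraph:
  assumes "inclusion \<Sigma> X Y"
  shows "hypergraph \<Sigma> X" "hypergraph \<Sigma> Y"
  using assms by (auto simp: inclusion_altdef)

lemma inclusion_parts: "inclusion \<Sigma> X Y \<Longrightarrow> parts X \<subseteq> parts Y"
  by (simp add: inclusion_altdef)

lemma inclusion_refl: "hypergraph \<Sigma> X \<Longrightarrow> inclusion \<Sigma> X X"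
  by (simp add: inclusion_altdef)

lemma inclusion_trans: "inclusion \<Sigma> X Y \<Longrightarrow> inclusion \<Sigma> Y Z \<Longrightarrow> inclusion \<Sigma> X Z"
  unfolding inclusion_altdef parts_subset_iff by (auto simp: subset_iff)

text \<open>Sub-graphs of one graph take labels and connections from it, so only containment of the
  underlying sets remains.\<close>

lemma inclusion_iff:
  assumes "inclusion \<Sigma> X W" "inclusion \<Sigma> Y W"
  shows "inclusion \<Sigma> X Y \<longleftrightarrow> parts X \<subseteq> parts Y"
  using assms unfolding inclusion_altdef parts_subset_iff by (auto simp: subset_iff)

lemma non_overlapping_altdef:
  "non_overlapping \<Sigma> X Y Z \<longleftrightarrow>
     inclusion \<Sigma> Y X \<and> inclusion \<Sigma> Y Z \<and> parts X \<inter> parts Z \<subseteq> parts Y"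
  unfolding non_overlapping_def parts_def by auto

lemma hypergraph_cnct_nodes: "hypergraph \<Sigma> X \<Longrightarrow> e \<in> edges X \<Longrightarrow> set (cnct X e) \<subseteq> nodes X"
  by (auto simp: hypergraph_def PiE_def Pi_def in_lists_conv_set)

text \<open>On the common edges, labels and connections come from \<open>W\<close>; elsewhere
  extensionality fixes them.\<close>

lemma inclusion_eqI:
  assumes "inclusion \<Sigma> X W" "inclusion \<Sigma> Y W" and "parts X = parts Y"
  shows "X = Y"
proof -
  have "lab X = lab Y" "cnct X = cnct Y"
    using assms by (auto simp: inclusion_altdef hypergraph_def parts_eq_iff PiE_def
        intro!: extensionalityI[where A = "edges X"])
  with assms(3) show ?thesis by (simp add: parts_eq_iff)
qed

lemma inclusion_union_graph:
  assumes "inclusion \<Sigma> X W" "inclusion \<Sigma> Y W"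
  shows "inclusion \<Sigma> (union_graph X Y) W"
proof -
  have "hypergraph \<Sigma> (union_graph X Y)"
    using assms unfolding inclusion_altdef hypergraph_def union_graph_def PiE_def Pi_def extensional_def
    by (auto simp: in_lists_conv_set)
  with assms show ?thesis
    by (auto simp: inclusion_altdef union_graph_def parts_subset_iff)
qed

lemma inclusion_inter_graph:
  assumes "inclusion \<Sigma> X W" "inclusion \<Sigma> Y W"
  shows "inclusion \<Sigma> (inter_graph X Y) W"
  using assms pullback_inclusions(1)[of \<Sigma> X W Y "inter_graph X Y"]
  by (auto simp: pullback_def intro: inclusion_trans)

lemma pushout_parts:
  assumes "pushout \<Sigma> X Y Z P"
  shows "parts X \<inter> parts Z = parts Y" "parts P = parts X \<union> parts Z"
  using assms by (auto simp: pushout_def non_overlapping_altdef dest: inclusion_parts)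

text \<open>Labels and connections are inherited from the ambient graph \<open>W\<close>, which
  leaves two set equations, one for the intersection and one for the union.\<close>

lemma pushout_iff:
  assumes "inclusion \<Sigma> X W" "inclusion \<Sigma> Y W" "inclusion \<Sigma> Z W" "inclusion \<Sigma> P W"
  shows "pushout \<Sigma> X Y Z P \<longleftrightarrow> parts X \<inter> parts Z = parts Y \<and> parts P = parts X \<union> parts Z"
proof
  assume *: "parts X \<inter> parts Z = parts Y \<and> parts P = parts X \<union> parts Z"
  have "inclusion \<Sigma> Y X" "inclusion \<Sigma> Y Z"
    using * inclusion_iff[OF assms(2,1)] inclusion_iff[OF assms(2,3)] by blast+
  moreover have "P = union_graph X Z"
    using * assms by (intro inclusion_eqI[of \<Sigma> P W]) (auto intro: inclusion_union_graph)
  ultimately show "pushout \<Sigma> X Y Z P"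
    using * by (simp add: pushout_def non_overlapping_altdef)
qed (auto dest: pushout_parts)

lemma pushout_inclusions0:
  assumes "pushout \<Sigma> X Y Z P"
  shows "inclusion \<Sigma> Y X" "inclusion \<Sigma> Y Z" "inclusion \<Sigma> Y P"
  using assms pushout_inclusions(1)[OF assms]
  by (auto simp: pushout_def non_overlapping_def intro: inclusion_trans)

lemma pullback_iff:
  assumes "inclusion \<Sigma> X P" "inclusion \<Sigma> Y P" "inclusion \<Sigma> K P"
  shows "pullback \<Sigma> X P Y K \<longleftrightarrow> parts K = parts X \<inter> parts Y"
  using assms inclusion_eqI[OF assms(3) inclusion_inter_graph[OF assms(1,2)]]
  by (auto simp: pullback_def)


section \<open>Embeddings and renamings\<close>

text \<open>Embeddings replace inclusions where a graph sits in another one only up to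
  isomorphism.\<close>

definition embedding ::
  "'l signature \<Rightarrow> ('e, 'v, 'e2, 'v2) hmap \<Rightarrow> ('e, 'v, 'l) hgraph \<Rightarrow> ('e2, 'v2, 'l) hgraph \<Rightarrow> bool"
where
  "embedding \<Sigma> \<phi> G W \<longleftrightarrow> morphism \<Sigma> \<phi> G W \<and> inj_on (on_parts \<phi>) (parts G)"

definition hmap_comp ::
  "('e2, 'v2, 'e3, 'v3) hmap \<Rightarrow> ('e, 'v, 'e2, 'v2) hmap \<Rightarrow> ('e, 'v, 'e3, 'v3) hmap" where
  "hmap_comp \<psi> \<phi> = (fst \<psi> \<circ> fst \<phi>, snd \<psi> \<circ> snd \<phi>)"

text \<open>Labels and connections are fetched back along \<open>inv_into\<close>, so this is a
  faithful copy when \<open>\<phi>\<close> is injective on \<open>G\<close>. The use of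
  \<open>restrict\<close> provides the extensionality that \<open>hypergraph\<close>
  demands.\<close>

definition rename ::
  "('e, 'v, 'e2, 'v2) hmap \<Rightarrow> ('e, 'v, 'l) hgraph \<Rightarrow> ('e2, 'v2, 'l) hgraph" where
  "rename \<phi> G =
     \<lparr>edges = fst \<phi> ` edges G, nodes = snd \<phi> ` nodes G,
      lab = restrict (\<lambda>e. lab G (inv_into (edges G) (fst \<phi>) e)) (fst \<phi> ` edges G),
      cnct = restrict (\<lambda>e. map (snd \<phi>) (cnct G (inv_into (edges G) (fst \<phi>) e)))
               (fst \<phi> ` edges G)\<rparr>"

lemma on_parts_comp: "on_parts (hmap_comp \<psi> \<phi>) = on_parts \<psi> \<circ> on_parts \<phi>"
  by (auto simp: on_parts_def hmap_comp_def sum.map_comp)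

lemma parts_rename [simp]: "parts (rename \<phi> G) = on_parts \<phi> ` parts G"
  unfolding parts_def Plus_def image_Un image_image by (simp add: rename_def on_parts_def image_image)

text \<open>The nodes attached to an edge of \<open>X\<close> belong to \<open>X\<close>, so values
  of the maps outside \<open>X\<close> never enter the construction.\<close>

lemma rename_cong:
  assumes hyp: "hypergraph \<Sigma> X" and ag: "agree_on X \<phi> \<psi>" and inj: "inj_on (on_parts \<phi>) (parts X)"
  shows "rename \<phi> X = rename \<psi> X"
proof -
  have e: "fst \<psi> e = fst \<phi> e" if "e \<in> edges X" for e
    using ag that by (simp add: agree_on_def)
  have inj': "inj_on (fst \<phi>) (edges X)" "inj_on (fst \<psi>) (edges X)"
    using inj e unfolding inj_on_parts_iff by (simp_all add: inj_on_def)
  have "inv_into (edges X) (fst \<psi>) (fst \<phi> x) = x" "inv_into (edges X) (fst \<phi>) (fst \<psi> x) = x"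
    if "x \<in> edges X" for x
    using inv_into_f_f[OF inj'(2) that] inv_into_f_f[OF inj'(1) that] e[OF that] by simp_all
  moreover have "map (snd \<phi>) (cnct X x) = map (snd \<psi>) (cnct X x)" if "x \<in> edges X" for x
    using hypergraph_cnct_nodes[OF hyp that] ag by (auto simp: agree_on_def)
  moreover have "fst \<phi> ` edges X = fst \<psi> ` edges X" "snd \<phi> ` nodes X = snd \<psi> ` nodes X"
    using ag by (auto simp: agree_on_def)
  ultimately show ?thesis
    using inj' e unfolding rename_def by (auto intro!: restrict_ext)
qed

section \<open>Composition, restriction and inversion of embeddings and isomorphisms\<close>

lemma morphism_parts: "morphism \<Sigma> \<phi> G H \<Longrightarrow> on_parts \<phi> ` parts G \<subseteq> parts H"
  by (auto simp: morphism_def parts_def on_parts_def)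

lemma morphism_comp: "morphism \<Sigma> \<phi> X Y \<Longrightarrow> morphism \<Sigma> \<psi> Y Z \<Longrightarrow> morphism \<Sigma> (hmap_comp \<psi> \<phi>) X Z"
  by (auto simp: morphism_def hmap_comp_def image_subset_iff)

lemma isomorphism_altdef:
  "isomorphism \<Sigma> \<phi> X Y \<longleftrightarrow> embedding \<Sigma> \<phi> X Y \<and> on_parts \<phi> ` parts X = parts Y"
proof -
  have "on_parts \<phi> ` parts X = parts Y \<longleftrightarrow> fst \<phi> ` edges X = edges Y \<and> snd \<phi> ` nodes X = nodes Y"
    unfolding parts_rename[symmetric] parts_eq_iff by (simp add: rename_def)
  then show ?thesis
    by (auto simp: isomorphism_def embedding_def bij_betw_def inj_on_parts_iff)
qed

lemma isomorphism_rename: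
  assumes "hypergraph \<Sigma> X" "inj_on (on_parts \<phi>) (parts X)"
  shows "isomorphism \<Sigma> \<phi> X (rename \<phi> X)"
proof -
  have inj: "inj_on (fst \<phi>) (edges X)"
    using assms by (simp add: inj_on_parts_iff)
  have "hypergraph \<Sigma> (rename \<phi> X)"
    unfolding hypergraph_def
  proof (intro conjI)
    show "lab (rename \<phi> X) \<in> edges (rename \<phi> X) \<rightarrow>\<^sub>E labels \<Sigma>"
      using assms(1) inj by (auto simp: rename_def hypergraph_def PiE_def Pi_def)
    show "cnct (rename \<phi> X) \<in> edges (rename \<phi> X) \<rightarrow>\<^sub>E lists (nodes (rename \<phi> X))"
      using hypergraph_cnct_nodes[OF assms(1)] inj
      by (fastforce simp: rename_def PiE_def Pi_def)
    show "\<forall>e\<in>edges (rename \<phi> X). length (cnct (rename \<phi> X) e) = arity \<Sigma> (lab (rename \<phi> X) e)"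
      using assms(1) inj by (auto simp: rename_def hypergraph_def)
  qed
  then show ?thesis
    using assms inj
    by (auto simp: isomorphism_altdef embedding_def morphism_def) (auto simp: rename_def)
qed

lemma embedding_parts:
  assumes "embedding \<Sigma> \<phi> X Y"
  shows "on_parts \<phi> ` parts X \<subseteq> parts Y" "inj_on (on_parts \<phi>) (parts X)"
  using assms morphism_parts[of \<Sigma> \<phi> X Y] by (simp_all add: embedding_def)

lemma embedding_comp:
  assumes "embedding \<Sigma> \<phi> X Y" "embedding \<Sigma> \<psi> Y Z"
  shows "embedding \<Sigma> (hmap_comp \<psi> \<phi>) X Z"
proof -
  have "inj_on (on_parts \<psi> \<circ> on_parts \<phi>) (parts X)"
    using embedding_parts[OF assms(1)] embedding_parts(2)[OF assms(2)]
    by (auto intro: comp_inj_on inj_on_subset)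
  then show ?thesis
    using assms by (auto simp: embedding_def on_parts_comp intro: morphism_comp)
qed

lemma embedding_inclusion: "inclusion \<Sigma> X Y \<Longrightarrow> embedding \<Sigma> (id, id) X Y"
  by (simp add: embedding_def inclusion_def inj_on_parts_iff)

lemma hmap_comp_id [simp]: "hmap_comp \<phi> (id, id) = \<phi>" "hmap_comp (id, id) \<phi> = \<phi>"
  by (simp_all add: hmap_comp_def)

lemma embedding_restrict: "embedding \<Sigma> \<phi> X Y \<Longrightarrow> inclusion \<Sigma> X' X \<Longrightarrow> embedding \<Sigma> \<phi> X' Y"
  using embedding_comp[OF embedding_inclusion, of \<Sigma> X' X \<phi> Y] by simp

lemma embedding_extend: "embedding \<Sigma> \<phi> X Y \<Longrightarrow> inclusion \<Sigma> Y Y' \<Longrightarrow> embedding \<Sigma> \<phi> X Y'"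
  using embedding_comp[OF _ embedding_inclusion, of \<Sigma> \<phi> X Y Y'] by simp

lemma isomorphism_comp:
  "isomorphism \<Sigma> \<phi> X Y \<Longrightarrow> isomorphism \<Sigma> \<psi> Y Z \<Longrightarrow> isomorphism \<Sigma> (hmap_comp \<psi> \<phi>) X Z"
  unfolding isomorphism_altdef on_parts_comp image_comp[symmetric]
  by (auto intro: embedding_comp)

lemma inclusion_rename:
  assumes "embedding \<Sigma> \<phi> X Y"
  shows "inclusion \<Sigma> (rename \<phi> X) Y"
proof -
  have "inj_on (fst \<phi>) (edges X)"
    using assms by (simp add: embedding_def inj_on_parts_iff)
  moreover have "hypergraph \<Sigma> (rename \<phi> X)"
    using isomorphism_rename[of \<Sigma> X \<phi>] assms by (simp add: embedding_def isomorphism_def morphism_def)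
  moreover have "on_parts \<phi> ` parts X \<subseteq> parts Y"
    using assms by (rule embedding_parts)
  ultimately show ?thesis
    using assms unfolding inclusion_altdef parts_rename embedding_def morphism_def
    by (auto simp: rename_def)
qed

lemma isomorphism_inverse:
  assumes "isomorphism \<Sigma> \<phi> X Y"
  obtains \<psi> where "isomorphism \<Sigma> \<psi> Y X" "\<And>x. x \<in> parts X \<Longrightarrow> on_parts \<psi> (on_parts \<phi> x) = x"
proof
  define \<psi> where "\<psi> = (inv_into (edges X) (fst \<phi>), inv_into (nodes X) (snd \<phi>))"
  have inj: "inj_on (fst \<phi>) (edges X)" "inj_on (snd \<phi>) (nodes X)"
    and im: "edges Y = fst \<phi> ` edges X" "nodes Y = snd \<phi> ` nodes X"
    and hyp: "hypergraph \<Sigma> X" "hypergraph \<Sigma> Y"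
    and pres: "\<And>e. e \<in> edges X \<Longrightarrow> lab Y (fst \<phi> e) = lab X e \<and> cnct Y (fst \<phi> e) = map (snd \<phi>) (cnct X e)"
    using assms by (auto simp: isomorphism_def bij_betw_def morphism_def)
  show inv: "on_parts \<psi> (on_parts \<phi> x) = x" if "x \<in> parts X" for x
    using that inj by (auto simp: \<psi>_def on_parts_def parts_def)
  have "map (snd \<psi>) (map (snd \<phi>) (cnct X e)) = cnct X e" if "e \<in> edges X" for e
    unfolding map_map using hypergraph_cnct_nodes[OF hyp(1) that] inj(2)
    by (intro map_idI) (auto simp: \<psi>_def)
  then have "morphism \<Sigma> \<psi> Y X"
    using hyp inj pres unfolding morphism_def im by (auto simp: \<psi>_def)
  moreover have "on_parts \<phi> ` parts X = parts Y"
    using assms by (simp add: isomorphism_altdef)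
  ultimately show "isomorphism \<Sigma> \<psi> Y X"
    using inv by (auto simp: isomorphism_altdef embedding_def inj_on_def image_image
        simp flip: \<open>on_parts \<phi> ` parts X = parts Y\<close>)
qed

text \<open>The universal property supplies \<open>\<chi>\<close>, and \<open>disj\<close> makes it
  injective: an item of \<open>X\<close> and an item of \<open>Z\<close> with the same image must
  both equal the item of \<open>Y\<close> that has this image.\<close>

lemma embedding_copair:
  assumes po: "pushout \<Sigma> X Y Z P"
    and \<phi>: "embedding \<Sigma> \<phi> X W" and \<psi>: "embedding \<Sigma> \<psi> Z W" and ag: "agree_on Y \<phi> \<psi>"
    and disj: "on_parts \<phi> ` parts X \<inter> on_parts \<psi> ` parts Z \<subseteq> on_parts \<phi> ` parts Y"
  obtains \<chi> where "embedding \<Sigma> \<chi> P W" "agree_on X \<chi> \<phi>" "agree_on Z \<chi> \<psi>"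
proof -
  obtain \<chi> where \<chi>: "morphism \<Sigma> \<chi> P W" and a: "agree_on X \<chi> \<phi>" "agree_on Z \<chi> \<psi>"
    using pushout_universal[OF po _ _ ag] \<phi> \<psi> unfolding embedding_def by blast
  note p = pushout_parts[OF po]
  have mixed: "x = z" if x: "x \<in> parts X" and z: "z \<in> parts Z" and eq: "on_parts \<phi> x = on_parts \<psi> z" for x z
  proof -
    obtain y where y: "y \<in> parts Y" "on_parts \<phi> x = on_parts \<phi> y"
      using disj x z eq by force
    then have "x = y"
      using \<phi> x p(1) unfolding embedding_def by (metis IntE inj_onD)
    moreover have "on_parts \<psi> y = on_parts \<psi> z"
      using y eq ag by (simp add: agree_on_parts)
    then have "y = z"
      using \<psi> z y p(1) unfolding embedding_def by (metis IntE inj_onD)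
    ultimately show ?thesis by simp
  qed
  have "inj_on (on_parts \<chi>) (parts P)"
  proof (rule inj_onI)
    fix x y
    assume "x \<in> parts P" "y \<in> parts P" and eq: "on_parts \<chi> x = on_parts \<chi> y"
    then consider "x \<in> parts X" "y \<in> parts X" | "x \<in> parts X" "y \<in> parts Z"
      | "x \<in> parts Z" "y \<in> parts X" | "x \<in> parts Z" "y \<in> parts Z"
      using p(2) by auto
    then show "x = y"
      using eq a \<phi> \<psi> mixed unfolding agree_on_parts embedding_def
      by cases (metis inj_onD)+
  qed
  then show ?thesis using that \<chi> a by (auto simp: embedding_def)
qed

section \<open>Fresh copies in infinite types\<close>

lemma disjoint_injections_infinite:
  assumes "infinite (UNIV :: 'a set)"
  obtains a b :: "'a \<Rightarrow> 'a" where "inj a" "inj b" "range a \<inter> range b = {}"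
proof -
  \<comment> \<open>An infinite set is equipotent with the disjoint sum of two copies of itself;
    composing the bijection with \<open>Inl\<close> and \<open>Inr\<close> yields the two
    halves.\<close>
  have "(card_of ((UNIV :: 'a set) <+> (UNIV :: 'a set)), card_of (UNIV :: 'a set)) \<in> ordIso"
    using assms card_of_Plus_infinite1 card_of_mono1 by blast
  then obtain f :: "'a + 'a \<Rightarrow> 'a" where "bij_betw f (UNIV <+> UNIV) UNIV"
    using card_of_ordIso by blast
  then have f: "inj f" by (simp add: bij_betw_def)
  then have "inj (f \<circ> Inl)" "inj (f \<circ> Inr)"
    by (simp_all add: inj_compose)
  moreover have "range (f \<circ> Inl) \<inter> range (f \<circ> Inr) = {}"
    by (auto simp: inj_eq[OF f])
  ultimately show ?thesis by (rule that)
qed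

lemma disjoint_injections:
  obtains a b :: "('e::infinite, 'v::infinite, 'e, 'v) hmap"
  where "inj (on_parts a)" "inj (on_parts b)" "range (on_parts a) \<inter> range (on_parts b) = {}"
proof -
  obtain a b :: "'e \<Rightarrow> 'e" where e: "inj a" "inj b" "range a \<inter> range b = {}"
    by (rule disjoint_injections_infinite[OF infinite_UNIV])
  obtain a' b' :: "'v \<Rightarrow> 'v" where v: "inj a'" "inj b'" "range a' \<inter> range b' = {}"
    by (rule disjoint_injections_infinite[OF infinite_UNIV])
  have "on_parts (a, a') x \<noteq> on_parts (b, b') y" for x y
  proof -
    have "a u \<noteq> b w" "a' p \<noteq> b' q" for u w p q
      using e(3) v(3) by blast+
    then show ?thesis
      by (cases x; cases y) (simp_all add: on_parts_def)
  qed
  then have "range (on_parts (a, a')) \<inter> range (on_parts (b, b')) = {}"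
    by blast
  moreover have "inj (on_parts (a, a'))" "inj (on_parts (b, b'))"
    using e v by (simp_all add: on_parts_def sum.inj_map)
  ultimately show ?thesis using that by blast
qed

text \<open>This is the pushout of \<open>E\<close> and \<open>W\<close> along \<open>J\<close>,
  built so that \<open>W\<close> stays a literal sub-graph: \<open>b\<close> sends the items of
  \<open>E\<close> outside \<open>J\<close> to places that \<open>W\<close> does not occupy.\<close>

lemma glue_fresh_copy:
  fixes J E :: "('e, 'v, 'l) hgraph" and b :: "('e, 'v, 'e2, 'v2) hmap"
  assumes \<phi>: "embedding \<Sigma> \<phi> J W" and JE: "inclusion \<Sigma> J E"
    and b: "inj (on_parts b)" "parts W \<inter> range (on_parts b) = {}"
  obtains W' \<epsilon> where "inclusion \<Sigma> W W'" "embedding \<Sigma> \<epsilon> E W'" "agree_on J \<epsilon> \<phi>"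
    "on_parts \<epsilon> ` parts E \<inter> parts W = on_parts \<phi> ` parts J"
proof -
  define \<epsilon> where "\<epsilon> = (\<lambda>e. if e \<in> edges J then fst \<phi> e else fst b e,
                       \<lambda>v. if v \<in> nodes J then snd \<phi> v else snd b v)"
  have \<epsilon>: "on_parts \<epsilon> x = (if x \<in> parts J then on_parts \<phi> x else on_parts b x)" for x
    by (cases x) (auto simp: \<epsilon>_def on_parts_def)
  have ag: "agree_on J \<epsilon> \<phi>"
    by (simp add: agree_on_parts \<epsilon>)
  have JW: "on_parts \<phi> ` parts J \<subseteq> parts W" and injJ: "inj_on (on_parts \<phi>) (parts J)"
    using embedding_parts[OF \<phi>] by simp_all
  have sep: "on_parts b x \<noteq> on_parts \<phi> y" if "y \<in> parts J" for x y
    using b(2) JW that by blast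
  have inj: "inj_on (on_parts \<epsilon>) (parts E)"
    using sep sep[symmetric] injD[OF b(1)] inj_onD[OF injJ]
    by (intro inj_onI) (auto simp: \<epsilon> split: if_splits)
  have meet: "on_parts \<epsilon> ` parts E \<inter> parts W = on_parts \<phi> ` parts J"
    using b(2) JW inclusion_parts[OF JE] by (auto simp: \<epsilon>)
  have iso: "isomorphism \<Sigma> \<epsilon> E (rename \<epsilon> E)"
    using JE inj by (intro isomorphism_rename) (auto dest: inclusion_hypergraph)
  then have \<epsilon>E: "embedding \<Sigma> \<epsilon> E (rename \<epsilon> E)"
    by (simp add: isomorphism_altdef)
  \<comment> \<open>This equality makes the copy of \<open>J\<close> in \<open>W\<close> literally a
    sub-graph of the copy of \<open>E\<close>, as gluing by union requires.\<close>
  have "rename \<phi> J = rename \<epsilon> J"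
    using rename_cong[OF inclusion_hypergraph(1)[OF JE] ag inj_on_subset[OF inj inclusion_parts[OF JE]]] by simp
  then have "inclusion \<Sigma> (rename \<phi> J) (rename \<epsilon> E)"
    using inclusion_rename[OF embedding_restrict[OF \<epsilon>E JE]] by simp
  then have po: "pushout \<Sigma> (rename \<epsilon> E) (rename \<phi> J) W (union_graph (rename \<epsilon> E) W)"
    using inclusion_rename[OF \<phi>] meet by (simp add: pushout_def non_overlapping_altdef)
  show ?thesis
    using that[OF pushout_inclusions(2)[OF po] embedding_extend[OF \<epsilon>E pushout_inclusions(1)[OF po]] ag meet] .
qed

text \<open>The image \<open>rename \<phi> X\<close> and \<open>Z\<close> are sub-graphs of
  \<open>Y\<close> with the same items, hence equal.\<close>

lemma embedding_isomorphism:
  assumes "embedding \<Sigma> \<phi> X Y" "inclusion \<Sigma> Z Y" "on_parts \<phi> ` parts X = parts Z"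
  shows "isomorphism \<Sigma> \<phi> X Z"
proof -
  have "rename \<phi> X = Z"
    using assms inclusion_eqI[OF inclusion_rename[OF assms(1)] assms(2)] by simp
  moreover have "hypergraph \<Sigma> X"
    using assms(1) by (simp add: embedding_def morphism_def)
  ultimately show ?thesis
    using isomorphism_rename[of \<Sigma> X \<phi>] embedding_parts(2)[OF assms(1)] by simp
qed


section \<open>Transitions embedded into an ambient graph\<close>

text \<open>The isomorphisms from the original rule are composed with \<open>a\<close>. Since
  \<open>a\<close> is injective across \<open>L\<close> and \<open>R\<close> together, the two sides
  stay non-overlapping.\<close>

lemma rule_instance_rename:
  assumes "rule_instance \<Sigma> \<R> L I R" "inj (on_parts a)" and LR: "inclusion \<Sigma> L W" "inclusion \<Sigma> R W"
  shows "rule_instance \<Sigma> \<R> (rename a L) (rename a I) (rename a R)"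
proof -
  obtain L0 I0 R0 l r where rule: "(L0, I0, R0) \<in> \<R>"
    and iso: "isomorphism \<Sigma> l L0 L" "isomorphism \<Sigma> r R0 R" "isomorphism \<Sigma> l I0 I" "agree_on I0 l r"
    using assms(1) by (auto simp: rule_instance_def)
  have IL: "inclusion \<Sigma> I L" "inclusion \<Sigma> I R" "parts L \<inter> parts R \<subseteq> parts I"
    using assms(1) by (auto simp: rule_instance_def is_rule_def non_overlapping_altdef)
  have inj: "inj_on (on_parts a) X" for X
    using assms(2) by (rule inj_on_subset) simp
  have iso_a: "isomorphism \<Sigma> a X (rename a X)" if "hypergraph \<Sigma> X" for X
    using that inj by (rule isomorphism_rename)
  note hyp = inclusion_hypergraph(1)[OF LR(1)] inclusion_hypergraph(1)[OF LR(2)]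
    inclusion_hypergraph(1)[OF IL(1)]
  have emb: "embedding \<Sigma> a L (rename a L)" "embedding \<Sigma> a R (rename a R)"
    using hyp iso_a by (simp_all add: isomorphism_altdef)
  have "inclusion \<Sigma> (rename a I) (rename a L)" "inclusion \<Sigma> (rename a I) (rename a R)"
    using inclusion_rename embedding_restrict emb IL by blast+
  then have "is_rule \<Sigma> (rename a L, rename a I, rename a R)"
    using IL(3) by (simp add: is_rule_def non_overlapping_altdef image_Int[OF assms(2), symmetric] image_mono)
  moreover have "agree_on I0 (hmap_comp a l) (hmap_comp a r)"
    using iso(4) by (simp add: agree_on_parts on_parts_comp)
  ultimately show ?thesis
    using rule isomorphism_comp[OF iso(1) iso_a] isomorphism_comp[OF iso(2) iso_a]
      isomorphism_comp[OF iso(3) iso_a] hyp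
    unfolding rule_instance_def by blast
qed

text \<open>Maps that agree on \<open>J\<close> have inverses that agree on its image
  \<open>J'\<close>, and likewise for \<open>K\<close>.\<close>

lemma transition_iso_sym:
  assumes "transition_iso \<Sigma> J G F K H J' G' F' K' H'"
  shows "transition_iso \<Sigma> J' G' F' K' H' J G F K H"
proof -
  obtain g f h where iso: "isomorphism \<Sigma> g G G'" "isomorphism \<Sigma> f F F'" "isomorphism \<Sigma> h H H'"
    "isomorphism \<Sigma> g J J'" "agree_on J g f" "isomorphism \<Sigma> f K K'" "agree_on K f h"
    using assms by (auto simp: transition_iso_def)
  have inc: "inclusion \<Sigma> J G" "inclusion \<Sigma> J F" "inclusion \<Sigma> K F" "inclusion \<Sigma> K H"
    "inclusion \<Sigma> J' G'" "inclusion \<Sigma> J' F'" "inclusion \<Sigma> K' F'" "inclusion \<Sigma> K' H'"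
    using assms by (auto simp: transition_iso_def is_state_def is_label_def)
  obtain g' where g': "isomorphism \<Sigma> g' G' G" "\<And>x. x \<in> parts G \<Longrightarrow> on_parts g' (on_parts g x) = x"
    using isomorphism_inverse[OF iso(1)] by blast
  obtain f' where f': "isomorphism \<Sigma> f' F' F" "\<And>x. x \<in> parts F \<Longrightarrow> on_parts f' (on_parts f x) = x"
    using isomorphism_inverse[OF iso(2)] by blast
  obtain h' where h': "isomorphism \<Sigma> h' H' H" "\<And>x. x \<in> parts H \<Longrightarrow> on_parts h' (on_parts h x) = x"
    using isomorphism_inverse[OF iso(3)] by blast
  have J': "parts J' = on_parts g ` parts J" and K': "parts K' = on_parts f ` parts K"
    using iso(4,6) by (simp_all add: isomorphism_altdef)
  have sub: "parts J \<subseteq> parts G" "parts J \<subseteq> parts F" "parts K \<subseteq> parts F" "parts K \<subseteq> parts H"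
    using inc by (simp_all add: inclusion_parts)
  have "isomorphism \<Sigma> g' J' J"
  proof (rule embedding_isomorphism[OF _ inc(1)])
    show "embedding \<Sigma> g' J' G"
      using g'(1) inc(5) by (auto simp: isomorphism_altdef intro: embedding_restrict)
    show "on_parts g' ` parts J' = parts J"
      using g'(2) sub(1) by (force simp: J' image_image subset_iff)
  qed
  moreover have "isomorphism \<Sigma> f' K' K"
  proof (rule embedding_isomorphism[OF _ inc(3)])
    show "embedding \<Sigma> f' K' F"
      using f'(1) inc(7) by (auto simp: isomorphism_altdef intro: embedding_restrict)
    show "on_parts f' ` parts K' = parts K"
      using f'(2) sub(3) by (force simp: K' image_image subset_iff)
  qed
  moreover have "agree_on J' g' f'"
    using iso(5) g'(2) f'(2) sub by (fastforce simp: agree_on_parts J')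
  moreover have "agree_on K' f' h'"
    using iso(7) h'(2) f'(2) sub by (fastforce simp: agree_on_parts K')
  ultimately show ?thesis
    using assms g'(1) f'(1) h'(1) unfolding transition_iso_def by blast
qed

text \<open>Up to isomorphism a BC-transition is given by embeddings \<open>g\<close>, \<open>f\<close>, \<open>h\<close> of \<open>G\<close>, \<open>F\<close>, \<open>H\<close> into
  a single graph \<open>W\<close> that contains \<open>G\<^sub>c\<close> and \<open>R\<close>; all pushouts and pullbacks are then equations
  between sets of edges and nodes of \<open>W\<close>.\<close>

definition bc_embedding ::
  "'l signature \<Rightarrow> ('e, 'v, 'l) rule set
    \<Rightarrow> ('e, 'v, 'l) hgraph \<Rightarrow> ('e, 'v, 'l) hgraph \<Rightarrow> ('e, 'v, 'l) hgraph
    \<Rightarrow> ('e, 'v, 'l) hgraph \<Rightarrow> ('e, 'v, 'l) hgraph \<Rightarrow> ('e, 'v, 'l) hgraph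
    \<Rightarrow> ('e, 'v, 'e, 'v) hmap \<Rightarrow> ('e, 'v, 'e, 'v) hmap \<Rightarrow> ('e, 'v, 'e, 'v) hmap
    \<Rightarrow> ('e, 'v, 'l) hgraph \<Rightarrow> ('e, 'v, 'l) hgraph \<Rightarrow> ('e, 'v, 'l) hgraph \<Rightarrow> ('e, 'v, 'l) hgraph
    \<Rightarrow> bool" where
  "bc_embedding \<Sigma> \<R> J G F K H W g f h L I R C \<longleftrightarrow>
     (inclusion \<Sigma> J G \<and> inclusion \<Sigma> J F \<and> inclusion \<Sigma> K F \<and> inclusion \<Sigma> K H) \<and>
     rule_instance \<Sigma> \<R> L I R \<and>
     (inclusion \<Sigma> L W \<and> inclusion \<Sigma> R W \<and> inclusion \<Sigma> C W) \<and>
     (embedding \<Sigma> g G W \<and> embedding \<Sigma> f F W \<and> embedding \<Sigma> h H W) \<and>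
     (agree_on J g f \<and> agree_on K f h) \<and>
     on_parts g ` parts G \<inter> on_parts f ` parts F = on_parts g ` parts J \<and>
     parts L \<union> on_parts g ` parts G = on_parts g ` parts G \<union> on_parts f ` parts F \<and>
     parts L \<inter> parts C = parts I \<and>
     parts L \<union> parts C = on_parts g ` parts G \<union> on_parts f ` parts F \<and>
     parts C \<inter> parts R = parts I \<and>
     parts C \<union> parts R = on_parts h ` parts H \<and>
     on_parts f ` parts F \<inter> parts C = on_parts f ` parts K"

section \<open>Closure of embedded transitions under renaming and under the SOSBC rules\<close>

lemma bc_embedding_rename:
  assumes bc: "bc_embedding \<Sigma> \<R> J G F K H W g f h L I R C" and a: "inj (on_parts a)"
  shows "bc_embedding \<Sigma> \<R> J G F K H (rename a W) (hmap_comp a g) (hmap_comp a f) (hmap_comp a h)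
           (rename a L) (rename a I) (rename a R) (rename a C)"
proof -
  have inc: "inclusion \<Sigma> L W" "inclusion \<Sigma> R W" "inclusion \<Sigma> C W" and rule: "rule_instance \<Sigma> \<R> L I R"
    using bc by (simp_all add: bc_embedding_def)
  have "isomorphism \<Sigma> a W (rename a W)"
    using isomorphism_rename[OF inclusion_hypergraph(2)[OF inc(1)]] a by (metis inj_on_subset subset_UNIV)
  then have emb: "embedding \<Sigma> a W (rename a W)"
    by (simp add: isomorphism_altdef)
  have "inclusion \<Sigma> (rename a X) (rename a W)" if "inclusion \<Sigma> X W" for X
    using inclusion_rename[OF embedding_restrict[OF emb that]] .
  moreover have "embedding \<Sigma> (hmap_comp a g) G (rename a W)" "embedding \<Sigma> (hmap_comp a f) F (rename a W)"
    "embedding \<Sigma> (hmap_comp a h) H (rename a W)"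
    using bc by (simp_all add: bc_embedding_def embedding_comp[OF _ emb])
  moreover have "agree_on J (hmap_comp a g) (hmap_comp a f)" "agree_on K (hmap_comp a f) (hmap_comp a h)"
    using bc by (auto simp: bc_embedding_def agree_on_parts on_parts_comp)
  ultimately show ?thesis
    using bc rule_instance_rename[OF rule a inc(1,2)]
    unfolding bc_embedding_def parts_rename on_parts_comp image_comp[symmetric]
      image_Int[OF a, symmetric] image_Un[symmetric]
    by simp
qed

text \<open>With state \<open>D\<close> and label graph \<open>L\<close>, the graph
  \<open>Gc\<close> is \<open>L\<close> itself and \<open>C\<close> is \<open>I\<close>. The union
  of \<open>L\<close> and \<open>R\<close> serves as ambient graph, with identities as
  embeddings.\<close>

lemma bc_embedding_basic_action:
  assumes rule: "rule_instance \<Sigma> \<R> L I R" and D: "inclusion \<Sigma> D L"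
  shows "\<exists>W g f h L' I' R' C. bc_embedding \<Sigma> \<R> D D L I R W g f h L' I' R' C"
proof -
  have "pushout \<Sigma> L I R (union_graph L R)"
    using rule by (simp add: rule_instance_def is_rule_def pushout_def)
  note po = pushout_parts(1)[OF this] pushout_inclusions[OF this] pushout_inclusions0[OF this]
  have "bc_embedding \<Sigma> \<R> D D L I R (union_graph L R) (id, id) (id, id) (id, id) L I R I"
    using rule D po inclusion_parts[OF D] inclusion_refl[OF inclusion_hypergraph(1)[OF D]]
    by (auto simp: bc_embedding_def on_parts_def sum.map_id0 agree_on_def
        intro: embedding_inclusion inclusion_trans)
  then show ?thesis by blast
qed

text \<open>Narrowing removes from \<open>F\<close> only items of \<open>J\<close>, and
  \<open>G\<close> provides all of these. The images of \<open>G\<close> and of the label graph thus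
  have the same union as before, so ambient graph, embeddings and rule can be kept.\<close>

lemma bc_embedding_narrowing:
  assumes bc: "bc_embedding \<Sigma> \<R> J G F K H W g f h L I R C"
    and J': "inclusion \<Sigma> J' J" and F': "pushout_complement \<Sigma> F J J' F'" and K': "pullback \<Sigma> F' F K K'"
  shows "bc_embedding \<Sigma> \<R> J' G F' K' H W g f h L I R C"
proof -
  have po: "pushout \<Sigma> J J' F' F" and F'F: "inclusion \<Sigma> F' F"
    using F' by (auto simp: pushout_complement_def)
  note pF = pushout_parts[OF po]
  have pK: "parts K' = parts F' \<inter> parts K"
    using K' by (simp add: pullback_def)
  have inc: "inclusion \<Sigma> J G" "inclusion \<Sigma> K F" "inclusion \<Sigma> K H" and f: "embedding \<Sigma> f F W"
    and ag: "agree_on J g f" "agree_on K f h"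
    using bc by (simp_all add: bc_embedding_def)
  have inj: "inj_on (on_parts f) (parts F)"
    using embedding_parts(2)[OF f] .
  have KF: "parts K \<subseteq> parts F"
    using inc by (simp add: inclusion_parts)
  have ag': "agree_on J' g f" "agree_on K' f h"
    using ag pF pK by (auto simp: agree_on_parts)
  \<comment> \<open>Images commute with intersections here because \<open>f\<close> is injective on
    all of \<open>F\<close>.\<close>
  have fJ': "on_parts f ` parts J' = on_parts f ` parts J \<inter> on_parts f ` parts F'"
    using inj_on_image_Int[OF inj, of "parts J" "parts F'"] pF by simp
  have fK': "on_parts f ` parts K' = on_parts f ` parts F' \<inter> on_parts f ` parts K"
    using inj_on_image_Int[OF inj, of "parts F'" "parts K"] pF pK KF by simp
  have fF: "on_parts f ` parts F = on_parts f ` parts J \<union> on_parts f ` parts F'"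
    using pF by blast
  have gJ: "on_parts g ` parts J = on_parts f ` parts J" "on_parts g ` parts J' = on_parts f ` parts J'"
    using ag(1) ag'(1) by (simp_all add: agree_on_image)
  have subsets: "on_parts g ` parts J \<subseteq> on_parts g ` parts G" "on_parts f ` parts K \<subseteq> on_parts f ` parts F"
    using inc(1) KF by (simp_all add: image_mono inclusion_parts)
  have old: "on_parts g ` parts G \<inter> on_parts f ` parts F = on_parts g ` parts J"
    "on_parts f ` parts F \<inter> parts C = on_parts f ` parts K"
    using bc by (simp_all add: bc_embedding_def)
  have sets:
    "on_parts g ` parts G \<inter> on_parts f ` parts F' = on_parts g ` parts J'"
    "on_parts g ` parts G \<union> on_parts f ` parts F' = on_parts g ` parts G \<union> on_parts f ` parts F"
    "on_parts f ` parts F' \<inter> parts C = on_parts f ` parts K'"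
    using old subsets unfolding fJ' fK' gJ fF
    by (simp_all only: set_eq_iff subset_iff Un_iff Int_iff) metis+
  have "inclusion \<Sigma> J' G" "inclusion \<Sigma> J' F'" "inclusion \<Sigma> K' F'" "inclusion \<Sigma> K' H" "embedding \<Sigma> f F' W"
    using J' pushout_inclusions0[OF po] pullback_inclusions[OF K'] inc f F'F
    by (auto intro: inclusion_trans embedding_restrict)
  then show ?thesis
    using bc ag' unfolding bc_embedding_def sets by simp
qed

text \<open>Composing the embeddings with the isomorphisms leaves the images in \<open>W\<close>
  unchanged.\<close>

lemma bc_embedding_iso:
  assumes bc: "bc_embedding \<Sigma> \<R> J G F K H W g f h L I R C"
    and iso: "transition_iso \<Sigma> J' G' F' K' H' J G F K H"
  shows "\<exists>g f h. bc_embedding \<Sigma> \<R> J' G' F' K' H' W g f h L I R C"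
proof -
  obtain g' f' h' where iso': "isomorphism \<Sigma> g' G' G" "isomorphism \<Sigma> f' F' F" "isomorphism \<Sigma> h' H' H"
    "isomorphism \<Sigma> g' J' J" "agree_on J' g' f'" "isomorphism \<Sigma> f' K' K" "agree_on K' f' h'"
    using iso by (auto simp: transition_iso_def)
  have ag: "agree_on J' (hmap_comp g g') (hmap_comp f f')" "agree_on K' (hmap_comp f f') (hmap_comp h h')"
  proof -
    have "agree_on J g f" "agree_on K f h"
      using bc by (simp_all add: bc_embedding_def)
    then show "agree_on J' (hmap_comp g g') (hmap_comp f f')" "agree_on K' (hmap_comp f f') (hmap_comp h h')"
      using iso'(4-7) by (auto simp: agree_on_parts on_parts_comp isomorphism_altdef simp flip: ball_simps)
  qed
  have "bc_embedding \<Sigma> \<R> J' G' F' K' H' W (hmap_comp g g') (hmap_comp f f') (hmap_comp h h') L I R C"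
    using bc iso ag iso' unfolding bc_embedding_def on_parts_comp image_comp[symmetric]
      isomorphism_altdef transition_iso_def is_state_def is_label_def
    by (auto intro: embedding_comp)
  then show ?thesis by blast
qed

text \<open>The ambient graph grows by a fresh copy of \<open>E\<close> glued along
  \<open>J\<close>, and \<open>C\<close> grows by the image of \<open>E'\<close>. Freshness prevents
  the new items from meeting \<open>G\<close>, \<open>F\<close>, \<open>H\<close> or the rule by
  accident.\<close>

lemma bc_embedding_contextualization:
  fixes J :: "('e::infinite, 'v::infinite, 'l) hgraph"
  assumes bc: "bc_embedding \<Sigma> \<R> J G F K H W g f h L I R C"
    and comp: "compatible_via \<Sigma> J E J' F K E1 E'"
    and F': "pushout \<Sigma> E J' F' E1" and K': "pullback \<Sigma> F' E1 E' K'"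
    and G': "pushout \<Sigma> E J G G'" and H': "pushout \<Sigma> E' K H H'"
  shows "\<exists>W g f h L I R C. bc_embedding \<Sigma> \<R> J' G' F' K' H' W g f h L I R C"
proof -
  obtain a b :: "('e, 'v, 'e, 'v) hmap"
    where a: "inj (on_parts a)" and b: "inj (on_parts b)" "range (on_parts a) \<inter> range (on_parts b) = {}"
    by (rule disjoint_injections)
  \<comment> \<open>The renamed diagram lies in the range of \<open>a\<close>, so the range of
    \<open>b\<close> is free. The old names now denote the renamed diagram.\<close>
  obtain W g f h L I R C where bc: "bc_embedding \<Sigma> \<R> J G F K H W g f h L I R C"
    and "parts W \<inter> range (on_parts b) = {}"
    using bc_embedding_rename[OF bc a] b(2) by (metis (no_types, lifting) parts_rename Int_mono image_mono
        order_refl subset_UNIV subset_empty)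
  have po1: "pushout \<Sigma> E J F E1" and po2: "pushout \<Sigma> F K E' E1"
    and JE: "inclusion \<Sigma> J E" and JJ': "inclusion \<Sigma> J J'"
    using comp by (auto simp: compatible_via_def non_inhibiting_via_def monotone_context_def is_context_def)
  have inc: "inclusion \<Sigma> J G" "inclusion \<Sigma> J F" "inclusion \<Sigma> K F" "inclusion \<Sigma> K H"
    and rule: "rule_instance \<Sigma> \<R> L I R"
    and incW: "inclusion \<Sigma> L W" "inclusion \<Sigma> R W" "inclusion \<Sigma> C W"
    and g: "embedding \<Sigma> g G W" and f: "embedding \<Sigma> f F W" and h: "embedding \<Sigma> h H W"
    and ag: "agree_on J g f" "agree_on K f h"
    using bc unfolding bc_embedding_def by blast+
  obtain W' \<epsilon> where WW': "inclusion \<Sigma> W W'" and \<epsilon>: "embedding \<Sigma> \<epsilon> E W'" and ag\<epsilon>: "agree_on J \<epsilon> g"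
    and meet: "on_parts \<epsilon> ` parts E \<inter> parts W = on_parts g ` parts J"
    using glue_fresh_copy[OF embedding_restrict[OF g inc(1)] JE b(1) \<open>parts W \<inter> range (on_parts b) = {}\<close>]
    by blast
  have ag\<epsilon>f: "agree_on J \<epsilon> f"
    using ag\<epsilon> ag(1) by (simp add: agree_on_parts)
  note W = embedding_parts(1)[OF g] embedding_parts(1)[OF f] embedding_parts(1)[OF h]
    incW[THEN inclusion_parts]
  note gJ = agree_on_image[OF ag(1)] agree_on_image[OF ag\<epsilon>]
  obtain g' where g': "embedding \<Sigma> g' G' W'" "agree_on E g' \<epsilon>" "agree_on G g' g"
    using embedding_copair[OF G' \<epsilon> embedding_extend[OF g WW'] ag\<epsilon>] meet W(1) gJ by blast
  \<comment> \<open>One embedding of \<open>E1\<close> serves \<open>E'\<close>, \<open>F'\<close>,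
    \<open>J'\<close> and \<open>K'\<close> at once, as all of them are sub-graphs of
    \<open>E1\<close>.\<close>
  obtain f1 where f1: "embedding \<Sigma> f1 E1 W'" "agree_on E f1 \<epsilon>" "agree_on F f1 f"
    using embedding_copair[OF po1 \<epsilon> embedding_extend[OF f WW'] ag\<epsilon>f] meet W(2) gJ by blast
  note inj = embedding_parts(2)[OF f1(1)]
  note p1 = pushout_parts[OF po1] and p2 = pushout_parts[OF po2] and pF' = pushout_parts[OF F']
    and pG' = pushout_parts[OF G'] and pH' = pushout_parts[OF H']
  have pK': "parts K' = parts F' \<inter> parts E'"
    using K' by (simp add: pullback_def)
  have sub: "parts J \<subseteq> parts F" "parts K \<subseteq> parts F" "parts J \<subseteq> parts J'"
    using inc JJ' by (simp_all add: inclusion_parts)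
  \<comment> \<open>The prefix \<open>i\<close> marks images in \<open>W'\<close>; the remaining
    conditions are statements about these sets.\<close>
  define iE iG iJ iF iK iH where
    "iE = on_parts \<epsilon> ` parts E" and "iG = on_parts g ` parts G" and "iJ = on_parts g ` parts J" and
    "iF = on_parts f ` parts F" and "iK = on_parts f ` parts K" and "iH = on_parts h ` parts H"
  define iE' iF' iJ' iK' where
    "iE' = on_parts f1 ` parts E'" and "iF' = on_parts f1 ` parts F'" and
    "iJ' = on_parts f1 ` parts J'" and "iK' = on_parts f1 ` parts K'"
  note idefs = iE_def iG_def iJ_def iF_def iK_def iH_def iE'_def iF'_def iJ'_def iK'_def
  have ag_sub: "agree_on J f1 f" "agree_on K f1 f"
    using f1(3) sub by (auto simp: agree_on_parts)
  have im: "on_parts f1 ` parts E = iE" "on_parts f1 ` parts F = iF" "on_parts f1 ` parts K = iK"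
    "on_parts f1 ` parts J = iJ" "on_parts g' ` parts E = iE" "on_parts g' ` parts G = iG"
    using agree_on_image[OF f1(2)] agree_on_image[OF f1(3)] agree_on_image[OF ag_sub(1)]
      agree_on_image[OF ag_sub(2)] gJ(1) agree_on_image[OF g'(2)] agree_on_image[OF g'(3)]
    by (simp_all add: idefs)
  have f1_Int: "on_parts f1 ` (A \<inter> B) = on_parts f1 ` A \<inter> on_parts f1 ` B"
    if "A \<subseteq> parts E1" "B \<subseteq> parts E1" for A B
    using inj_on_image_Int[OF inj that] .
  have inE1: "parts E \<subseteq> parts E1" "parts F \<subseteq> parts E1" "parts E' \<subseteq> parts E1" "parts F' \<subseteq> parts E1"
    using p1 p2 pF' by blast+
  have E_F: "iE \<union> iF = iF \<union> iE'" "iE \<union> iF = iE \<union> iF'"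
    using arg_cong[OF p1(2), of "image (on_parts f1)"] arg_cong[OF p2(2), of "image (on_parts f1)"]
      arg_cong[OF pF'(2), of "image (on_parts f1)"] im by (simp_all add: image_Un idefs(7-))
  have meets: "iF \<inter> iE' = iK" "iE \<inter> iF' = iJ'" "iK' = iF' \<inter> iE'" "iJ \<subseteq> iF" "iJ \<subseteq> iJ'" "iK \<subseteq> iF"
    using f1_Int[of "parts F" "parts E'"] f1_Int[of "parts E" "parts F'"] f1_Int[of "parts F'" "parts E'"]
      p2(1) pF'(1) pK' inE1 im image_mono[OF sub(1), of "on_parts f1"]
      image_mono[OF sub(3), of "on_parts f1"] image_mono[OF sub(2), of "on_parts f1"]
    by (simp_all add: idefs(7-))
  have meetW: "iE \<inter> parts W = iJ" and inW: "iG \<subseteq> parts W" "iF \<subseteq> parts W" "iH \<subseteq> parts W"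
    "parts L \<subseteq> parts W" "parts R \<subseteq> parts W" "parts C \<subseteq> parts W"
    using meet W by (simp_all add: idefs)
  \<comment> \<open>An item of \<open>iE'\<close> lies in \<open>iE\<close> or \<open>iF\<close>. If
    it is in \<open>W\<close> and in \<open>iE\<close>, then it is in \<open>iJ\<close>, hence in
    \<open>iF\<close> anyway, and \<open>iF\<close> meets \<open>iE'\<close> exactly in
    \<open>iK\<close>.\<close>
  have E'_W: "iE' \<inter> parts W \<subseteq> iK"
    using meetW meets E_F by blast
  have E'E1: "inclusion \<Sigma> E' E1"
    using pushout_inclusions[OF po2] by simp
  have agh: "agree_on K f1 h"
    using f1(3) ag(2) sub by (auto simp: agree_on_parts)
  \<comment> \<open>Since \<open>iH\<close> is contained in \<open>W\<close>, the images of
    \<open>E'\<close> and \<open>H\<close> meet only in that of \<open>K\<close>, so their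
    embeddings combine to an injective map on \<open>H'\<close>.\<close>
  have "iE' \<inter> iH \<subseteq> on_parts f1 ` parts K"
    unfolding im using E'_W inW by blast
  then obtain h' where h': "embedding \<Sigma> h' H' W'" "agree_on E' h' f1" "agree_on H h' h"
    using embedding_copair[OF H' embedding_restrict[OF f1(1) E'E1] embedding_extend[OF h WW'] agh]
    unfolding iE'_def iH_def by blast
  \<comment> \<open>\<open>C\<close> and \<open>iE'\<close> meet exactly in \<open>iK\<close>, so
    this glues \<open>E'\<close> to \<open>C\<close> along \<open>K\<close>.\<close>
  define C' where "C' = union_graph C (rename f1 E')"
  have C': "parts C' = parts C \<union> iE'"
    by (simp add: C'_def iE'_def)
  have incC': "inclusion \<Sigma> C' W'"
    unfolding C'_def
    by (intro inclusion_union_graph inclusion_trans[OF incW(3) WW'] inclusion_rename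
        embedding_restrict[OF f1(1) E'E1])
  have gG': "on_parts g' ` parts G' = iE \<union> iG"
    using im by (simp add: pG'(2) image_Un)
  have hH': "on_parts h' ` parts H' = iE' \<union> iH"
    using agree_on_image[OF h'(2)] agree_on_image[OF h'(3)] by (simp add: pH'(2) image_Un idefs)
  have "parts J' \<subseteq> parts E" "parts K' \<subseteq> parts E'"
    using pF' pK' by blast+
  then have agJ': "agree_on J' g' f1" and agK': "agree_on K' f1 h'"
    using g'(2) f1(2) h'(2) by (auto simp: agree_on_parts subset_iff)
  have old: "iG \<inter> iF = iJ" "parts L \<union> iG = iG \<union> iF" "parts L \<inter> parts C = parts I"
    "parts L \<union> parts C = iG \<union> iF" "parts C \<inter> parts R = parts I" "parts C \<union> parts R = iH"
    "iF \<inter> parts C = iK"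
    using bc unfolding bc_embedding_def idefs by simp_all
  \<comment> \<open>The equations for \<open>I\<close> survive because \<open>iE'\<close> meets
    \<open>L\<close> and \<open>R\<close> only inside \<open>iK\<close>, which \<open>C\<close>
    already contains. For the last one, an item of \<open>iF'\<close> in \<open>C\<close> lies in
    \<open>iF\<close>, hence in \<open>iK\<close> and so in \<open>iE'\<close>.\<close>
  have new: "on_parts g' ` parts G' \<inter> on_parts f1 ` parts F' = on_parts g' ` parts J'"
    "parts L \<union> on_parts g' ` parts G' = on_parts g' ` parts G' \<union> on_parts f1 ` parts F'"
    "parts L \<inter> parts C' = parts I"
    "parts L \<union> parts C' = on_parts g' ` parts G' \<union> on_parts f1 ` parts F'"
    "parts C' \<inter> parts R = parts I"
    "parts C' \<union> parts R = on_parts h' ` parts H'"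
    "on_parts f1 ` parts F' \<inter> parts C' = on_parts f1 ` parts K'"
    unfolding C' gG' hH' agree_on_image[OF agJ'] idefs(7-)[symmetric]
    subgoal using old(1) E_F(2) meets(2,5) meetW inW(1) by blast
    subgoal using old(2) E_F(2) by blast
    subgoal using old(3,7) E'_W inW(4) by blast
    subgoal using old(4) E_F by blast
    subgoal using old(5,7) E'_W inW(5) by blast
    subgoal using old(6) by blast
    subgoal using old(7) E_F meets meetW inW(6) by blast
    done
  have "inclusion \<Sigma> J' G'" "inclusion \<Sigma> J' F'" "inclusion \<Sigma> K' F'" "inclusion \<Sigma> K' H'" "inclusion \<Sigma> F' E1"
    using pushout_inclusions0[OF F'] pushout_inclusions[OF G'] pushout_inclusions[OF H']
      pushout_inclusions[OF F'] pullback_inclusions[OF K'] by (auto intro: inclusion_trans)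
  then have "bc_embedding \<Sigma> \<R> J' G' F' K' H' W' g' f1 h' L I R C'"
    unfolding bc_embedding_def using new rule incC' g'(1) embedding_restrict[OF f1(1)] h'(1) agJ' agK'
      inclusion_trans[OF incW(1) WW'] inclusion_trans[OF incW(2) WW']
    by - (intro conjI; simp only:)
  then show ?thesis by blast
qed

text \<open>The images of the five graphs are literal sub-graphs of \<open>W\<close> and form a
  diagram of unions and intersections; \<open>g\<close>, \<open>f\<close> and \<open>h\<close> are
  the isomorphisms onto it.\<close>

lemma bc_embedding_imp_bc_transition:
  assumes bc: "bc_embedding \<Sigma> \<R> J G F K H W g f h L I R C"
  shows "bc_transition \<Sigma> \<R> J G F K H"
proof -
  have inc: "inclusion \<Sigma> J G" "inclusion \<Sigma> J F" "inclusion \<Sigma> K F" "inclusion \<Sigma> K H"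
    and rule: "rule_instance \<Sigma> \<R> L I R"
    and incW: "inclusion \<Sigma> L W" "inclusion \<Sigma> R W" "inclusion \<Sigma> C W"
    and g: "embedding \<Sigma> g G W" and f: "embedding \<Sigma> f F W" and h: "embedding \<Sigma> h H W"
    and ag: "agree_on J g f" "agree_on K f h"
    using bc unfolding bc_embedding_def by blast+
  have sets: "on_parts g ` parts G \<inter> on_parts f ` parts F = on_parts g ` parts J"
    "parts L \<union> on_parts g ` parts G = on_parts g ` parts G \<union> on_parts f ` parts F"
    "parts L \<inter> parts C = parts I"
    "parts L \<union> parts C = on_parts g ` parts G \<union> on_parts f ` parts F"
    "parts C \<inter> parts R = parts I"
    "parts C \<union> parts R = on_parts h ` parts H"
    "on_parts f ` parts F \<inter> parts C = on_parts f ` parts K"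
    using bc by (simp_all add: bc_embedding_def)
  define J0 G0 F0 K0 H0 where
    "J0 = rename g J" and "G0 = rename g G" and "F0 = rename f F" and "K0 = rename f K" and "H0 = rename h H"
  have W: "inclusion \<Sigma> J0 W" "inclusion \<Sigma> G0 W" "inclusion \<Sigma> F0 W" "inclusion \<Sigma> K0 W" "inclusion \<Sigma> H0 W"
    unfolding J0_def G0_def F0_def K0_def H0_def
    by (intro inclusion_rename g f h embedding_restrict[OF g inc(1)] embedding_restrict[OF f inc(3)])+
  have IW: "inclusion \<Sigma> I W"
    using rule incW by (auto simp: rule_instance_def is_rule_def non_overlapping_def intro: inclusion_trans)
  note parts0 = J0_def G0_def F0_def K0_def H0_def
  have p0: "parts J0 = on_parts g ` parts J" "parts G0 = on_parts g ` parts G" "parts F0 = on_parts f ` parts F"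
    "parts K0 = on_parts f ` parts K" "parts H0 = on_parts h ` parts H"
    by (simp_all add: parts0)
  have im: "on_parts g ` parts J = on_parts f ` parts J" "on_parts f ` parts K = on_parts h ` parts K"
    using ag by (simp_all add: agree_on_image)
  have sub: "parts J \<subseteq> parts G" "parts J \<subseteq> parts F" "parts K \<subseteq> parts F" "parts K \<subseteq> parts H"
    using inc by (simp_all add: inclusion_parts)
  have inc0: "inclusion \<Sigma> J0 G0" "inclusion \<Sigma> J0 F0" "inclusion \<Sigma> K0 F0" "inclusion \<Sigma> K0 H0"
    using W im image_mono[OF sub(1), of "on_parts g"] image_mono[OF sub(2), of "on_parts f"]
      image_mono[OF sub(3), of "on_parts f"] image_mono[OF sub(4), of "on_parts h"]
    by (simp_all add: p0 inclusion_iff[where W = W])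
  \<comment> \<open>\<open>bc_embedding\<close> does not record \<open>D\<close>, but the pushout of
    \<open>L\<close> and \<open>G0\<close> forces it to be their intersection.\<close>
  define D where "D = inter_graph L G0"
  define Gc where "Gc = union_graph G0 F0"
  have W2: "inclusion \<Sigma> D W" "inclusion \<Sigma> Gc W"
    unfolding D_def Gc_def by (intro inclusion_inter_graph inclusion_union_graph incW W)+
  have p2: "parts D = parts L \<inter> parts G0" "parts Gc = parts G0 \<union> parts F0"
    by (simp_all add: D_def Gc_def)
  have "pushout \<Sigma> L D G0 Gc" "pushout \<Sigma> G0 J0 F0 Gc" "pushout \<Sigma> L I C Gc" "pushout \<Sigma> C I R H0"
    using W W2 IW incW sets by (auto simp: pushout_iff[where W = W] p0 p2)
  moreover have "pullback \<Sigma> F0 Gc C K0"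
  proof -
    have "inclusion \<Sigma> F0 Gc" "inclusion \<Sigma> C Gc"
      using W W2 incW sets(4) by (auto simp: inclusion_iff[where W = W] p2 p0)
    then show ?thesis
      using inc0 sets(7) pullback_iff[of \<Sigma> F0 Gc C K0] p0 by (auto intro: inclusion_trans)
  qed
  ultimately have "bc_diagram \<Sigma> \<R> J0 G0 F0 K0 H0"
    unfolding bc_diagram_def is_state_def is_label_def using inc0 rule by blast
  moreover have "transition_iso \<Sigma> J G F K H J0 G0 F0 K0 H0"
    unfolding transition_iso_def is_state_def is_label_def
    using inc inc0 ag embedding_isomorphism[OF g W(2)] embedding_isomorphism[OF f W(3)]
      embedding_isomorphism[OF h W(5)] embedding_isomorphism[OF embedding_restrict[OF g inc(1)] W(1)]
      embedding_isomorphism[OF embedding_restrict[OF f inc(3)] W(4)] p0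
    by (metis (no_types, lifting))
  ultimately show ?thesis
    unfolding bc_transition_def using transition_iso_sym by blast
qed


section \<open>Soundness and completeness\<close>

text \<open>Induction on the derivation. Infinite types give the contextualization case room for a
  fresh copy of the context.\<close>

lemma sosbc_imp_bc_embedding:
  fixes \<R> :: "('e::infinite, 'v::infinite, 'l) rule set"
  assumes "sosbc \<Sigma> \<R> J G F K H"
  shows "\<exists>W g f h L I R C. bc_embedding \<Sigma> \<R> J G F K H W g f h L I R C"
  using assms
proof induction
  case (basic_action L I R D)
  then show ?case by (rule bc_embedding_basic_action)
next
  case (interface_narrowing J G F K H J' F' K')
  then show ?case using bc_embedding_narrowing by meson
next
  case (compatible_contextualization J G F K H E J' E1 E' F' K' G' H')
  then show ?case using bc_embedding_contextualization by meson
next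
  case (up_to_iso J G F K H J' G' F' K' H')
  \<comment> \<open>Embeddings are pulled back along isomorphisms into the old transition, hence the
    reversed direction.\<close>
  then show ?case using bc_embedding_iso[OF _ transition_iso_sym] by meson
qed

text \<open>Apart from \<open>R\<close> and \<open>H\<close>, all graphs of the diagram lie in
  \<open>Gc\<close>, where the side conditions of both rules become set equations.\<close>

lemma bc_diagram_imp_sosbc:
  assumes "bc_diagram \<Sigma> \<R> J G F K H"
  shows "sosbc \<Sigma> \<R> J G F K H"
proof -
  obtain L I R D Gc C where rule: "rule_instance \<Sigma> \<R> L I R"
    and po1: "pushout \<Sigma> L D G Gc" and po2: "pushout \<Sigma> G J F Gc" and po3: "pushout \<Sigma> L I C Gc"
    and po4: "pushout \<Sigma> C I R H" and pb: "pullback \<Sigma> F Gc C K"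
    using assms by (auto simp: bc_diagram_def)
  note inc = pushout_inclusions[OF po1] pushout_inclusions0[OF po1] pushout_inclusions[OF po2]
    pushout_inclusions0[OF po2] pushout_inclusions[OF po3] pushout_inclusions0[OF po3]
  note p = pushout_parts[OF po1] pushout_parts[OF po2] pushout_parts[OF po3]
  have pK: "parts K = parts F \<inter> parts C"
    using pb by (simp add: pullback_def)
  have incK: "inclusion \<Sigma> K Gc"
    using pullback_inclusions(1)[OF pb] inc by (blast intro: inclusion_trans)
  \<comment> \<open>A monotone context needs an interface containing \<open>D\<close>, so
    \<open>D\<close> is added to \<open>J\<close> and, to keep the square with \<open>G\<close>,
    also to \<open>F\<close>. \<open>K'\<close> is the pullback that contextualization
    prescribes.\<close>
  define J' F' K' where "J' = union_graph J D" and "F' = union_graph F D" and "K' = inter_graph F' C"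
  have inc': "inclusion \<Sigma> J' Gc" "inclusion \<Sigma> F' Gc" "inclusion \<Sigma> K' Gc"
    unfolding J'_def F'_def K'_def using inc
    by (auto intro!: inclusion_union_graph inclusion_inter_graph)
  have p': "parts J' = parts J \<union> parts D" "parts F' = parts F \<union> parts D" "parts K' = parts F' \<inter> parts C"
    by (simp_all add: J'_def F'_def K'_def)
  have sub: "inclusion \<Sigma> D J'" "inclusion \<Sigma> J' G" "inclusion \<Sigma> J J'" "inclusion \<Sigma> J' F'" "inclusion \<Sigma> F F'"
    "inclusion \<Sigma> K F'"
  proof -
    have "parts D \<subseteq> parts J'" "parts J' \<subseteq> parts G" "parts J \<subseteq> parts J'" "parts J' \<subseteq> parts F'"
      "parts F \<subseteq> parts F'" "parts K \<subseteq> parts F'"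
      unfolding p' using p(1,3) pK by blast+
    then show "inclusion \<Sigma> D J'" "inclusion \<Sigma> J' G" "inclusion \<Sigma> J J'" "inclusion \<Sigma> J' F'" "inclusion \<Sigma> F F'"
      "inclusion \<Sigma> K F'"
      using inc inc' incK by (simp_all add: inclusion_iff[where W = Gc])
  qed
  have K'F': "inclusion \<Sigma> K' F'"
    using inc' p' inclusion_iff[of \<Sigma> K' Gc F'] by simp
  \<comment> \<open>The first three squares, with \<open>po3\<close> and \<open>po4\<close>,
    instantiate contextualization with \<open>E = G\<close>, \<open>E1 = Gc\<close> and
    \<open>E' = C\<close>; the degenerate second one says that the state graph \<open>D\<close>
    becomes \<open>G\<close>. The fourth exhibits \<open>F\<close> as the pushout complement for
    narrowing \<open>J'\<close> to \<open>J\<close>.\<close>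
  have "pushout \<Sigma> G D L Gc" "pushout \<Sigma> G D D G" "pushout \<Sigma> G J' F' Gc" "pushout \<Sigma> J' J F F'"
    using inc inc' p p' inclusion_refl[OF inclusion_hypergraph(2)[OF inc(1)]]
    by (auto simp: pushout_iff[where W = Gc])
  moreover have "pullback \<Sigma> F' Gc C K'"
    using inc inc' p' by (simp add: pullback_iff)
  \<comment> \<open>Narrowing returns exactly the original \<open>K\<close>: intersecting
    \<open>F\<close> with \<open>K'\<close> gives \<open>F \<inter> C\<close>, as \<open>F\<close>
    is contained in \<open>F'\<close>.\<close>
  moreover have "pullback \<Sigma> F F' K' K"
    using sub K'F' pK p' by (subst pullback_iff) auto
  ultimately have "sosbc \<Sigma> \<R> J' G F' K' H"
    using compatible_contextualization[OF basic_action[OF rule inc(3)], of G J' Gc C F' K' G H]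
      sub po3 po4 inc
    by (simp add: compatible_via_def monotone_context_def is_context_def non_inhibiting_via_def)
  then show ?thesis
    using \<open>pushout \<Sigma> J' J F F'\<close> \<open>pullback \<Sigma> F F' K' K\<close> sub
    by (intro interface_narrowing[of \<Sigma> \<R> J' G F' K' H J F K]) (auto simp: pushout_complement_def)
qed

theorem theorem3p6:
  fixes \<Sigma> :: "'l signature"
    and \<R> :: "('e::infinite, 'v::infinite, 'l) rule set"
    and J G F K H :: "('e, 'v, 'l) hgraph"
  assumes "graph_transformation_system \<Sigma> \<R>"
    and "is_state \<Sigma> J G"
    and "is_state \<Sigma> K H"
    and "is_label \<Sigma> J F K"
  shows "bc_transition \<Sigma> \<R> J G F K H \<longleftrightarrow> sosbc \<Sigma> \<R> J G F K H"
proof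
  assume "bc_transition \<Sigma> \<R> J G F K H"
  then show "sosbc \<Sigma> \<R> J G F K H"
    unfolding bc_transition_def by (blast intro: up_to_iso bc_diagram_imp_sosbc)
next
  assume "sosbc \<Sigma> \<R> J G F K H"
  then show "bc_transition \<Sigma> \<R> J G F K H"
    using sosbc_imp_bc_embedding bc_embedding_imp_bc_transition by meson
qed

end
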